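(* Let $X=X_\Sigma$ be the $n$-dimensional toric variety of a complete fan $\Sigma$ in $\mathbb{R}^n$ with $k$ rays, let $f,g\in S=\mathbb{C}[x_1,\dots,x_k]$ be nonzero homogeneous polynomials with positive coefficients and the same degree in $\mathrm{Cl}(X)$, with $\dim\mathcal{N}(g)=n$ and $\mathcal{N}(f)$ contained in the relative interior of $\mathcal{N}(g)$, and let $\mathcal{F}$ be a simplicial refinement of the normal fan of $\mathcal{N}(f)+\mathcal{N}(g)$ in $\mathbb{R}^k/\ker V$. Consider the following procedure. 1. Draw a cone $\sigma\in\mathcal{F}(n)$ with probability $\mathcal{I}^{\rm tr}_\sigma/\mathcal{I}^{\rm tr}$. 2. Draw $q$ uniformly from the unit cube $[0,1]^n$ (independently of $\sigma$). 3. Output the point of $X_{>0}$ with Cox coordinates $x^\sigma(q)=(x^\sigma_1(q),\dots,x^\sigma_k(q))$, where $x^\sigma_i(q)=\prod_{\ell=1}^n q_\ell^{-(w_\ell)_i/(w_\ell\cdot\delta_\sigma)}$. Then the output is a sample from the probability space $(X_{>0},\mu^{\rm tr}_{f,g})$, i.e. its distribution is the probability measure $\mu^{\rm tr}_{f,g}=\frac{1}{\mathcal{I}^{\rm tr}}\frac{f^{\rm tr}}{g^{\rm tr}}\,\Omega_X$.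
   Context: Let $\Sigma$ be a complete rational polyhedral fan in $\mathbb{R}^n$ with primitive ray generators $v_1,\dots,v_k\in\mathbb{Z}^n$, and $V=[v_1\,\cdots\,v_k]\in\mathbb{Z}^{n\times k}$. Let $X=X_\Sigma$ be the associated toric variety with dense torus $T=(\mathbb{C}^* )^n$ (coordinates $t_j$). The Cox ring $S=\mathbb{C}[x_1,\dots,x_k]$ is graded by $\mathrm{Cl}(X)=\mathbb{Z}^k/\mathrm{im}(V^\top)$ with $\deg x_i$ the class of the $i$-th unit vector. The Cox quotient map $\pi$ is given on $(\mathbb{C}^* )^k$ by $x\mapsto(\prod_i x_i^{(v_i)_j})_{j=1,\dots,n}\in T$, and $X_{>0}=\pi(\mathbb{R}^k_{>0})\simeq\mathbb{R}^n_{>0}$; the point with Cox coordinates $x\in\mathbb{R}^k_{>0}$ is $\pi(x)$. The canonical form is $\Omega_X=\sum_{|I|=n}\det(V_I)\bigwedge_{i\in I}\frac{\mathrm{d}x_i}{x_i}$; it is the pullback under $\pi$ of $\bigwedge_{j=1}^n\mathrm{d}t_j/t_j$, is viewed as a form on $X$, and $X_{>0}$ is oriented so that it is positive. For a polynomial $f$ with positive coefficients, $\mathcal{N}(f)\subset\mathbb{R}^k$ is its Newton polytope and $f^{\rm tr}(x)=\max_{\ell\in\mathrm{supp}(f)}x^\ell$ for $x\in\mathbb{R}^k_{>0}$. For $f,g$ homogeneous of the same degree, $f^{\rm tr}/g^{\rm tr}$ is viewed as a function on $X_{>0}$ (it is constant on fibres of $\pi:\mathbb{R}^k_{>0}\to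 X_{>0}$). Let $K=\ker(V)\subset\mathbb{R}^k$. Normal fans use the max convention (the cone of a face $F$ consists of the $y$ such that $y\cdot\nu$ is maximized on $F$). The normal fan of $\mathcal{N}(f)+\mathcal{N}(g)$ is viewed as a complete pointed fan in $\mathbb{R}^k/K\simeq\mathbb{R}^n$; $\mathcal{F}$ is a simplicial fan refining it, $\mathcal{F}(n)$ its set of $n$-dimensional cones. The exponential map is $\mathrm{Exp}:\mathbb{R}^k/K\to X_{>0}$, $[y]\mapsto\pi(e^{y_1},\dots,e^{y_k})$. For $\sigma\in\mathcal{F}(n)$: $w_1,\dots,w_n\in\mathbb{R}^k$ are (representatives of) generators of $\sigma$; $\delta_\sigma=\nu_g-\nu_f$, where $\nu_f,\nu_g$ are vertices of the faces of $\mathcal{N}(f),\mathcal{N}(g)$ maximized by vectors in the relative interior of $\sigma$; one has $w_\ell\cdot\delta_\sigma>0$. Finally $\mathcal{I}^{\rm tr}_\sigma=\int_{\mathrm{Exp}(\sigma)}\frac{f^{\rm tr}}{g^{\rm tr}}\Omega_X$ and $\mathcal{I}^{\rm tr}=\int_{X_{>0}}\frac{f^{\rm tr}}{g^{\rm tr}}\Omega_X=\sum_{\sigma\in\mathcal{F}(n)}\mathcal{I}^{\rm tr}_\sigma$, which is finite and positive. *)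

theory Defs
  imports "HOL-Probability.Probability" "HOL-Library.Poly_Mapping"
begin

section \<open>Fans\<close>

text \<open>
  A polyhedral fan in the quotient space \<open>E / L\<close>, for a linear subspace \<open>L\<close> of \<open>E\<close>. A subset of
  \<open>E / L\<close> is represented by its preimage in \<open>E\<close>, so a pointed polyhedral cone of \<open>E / L\<close> appears as
  a polyhedral cone of \<open>E\<close> whose lineality space is \<open>L\<close>. With \<open>L = {0}\<close> this is an ordinary fan
  of pointed cones in \<open>E\<close>.
\<close>

definition polyhedral_fan :: "'a::euclidean_space set \<Rightarrow> 'a set set \<Rightarrow> bool" where
  "polyhedral_fan L \<F> \<longleftrightarrow>
     finite \<F> \<and>
     (\<forall>\<sigma>\<in>\<F>. (\<exists>B. finite B \<and> \<sigma> = convex_cone hull (B \<union> L)) \<and> \<sigma> \<inter> uminus ` \<sigma> = L) \<and>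
     (\<forall>\<sigma>\<in>\<F>. \<forall>\<tau>. \<tau> face_of \<sigma> \<and> \<tau> \<noteq> {} \<longrightarrow> \<tau> \<in> \<F>) \<and>
     (\<forall>\<sigma>\<in>\<F>. \<forall>\<tau>\<in>\<F>. (\<sigma> \<inter> \<tau>) face_of \<sigma> \<and> (\<sigma> \<inter> \<tau>) face_of \<tau>)"

definition complete_fan :: "'a set set \<Rightarrow> bool" where
  "complete_fan \<F> \<longleftrightarrow> \<Union>\<F> = UNIV"

definition rational_cone :: "(real^'n) set \<Rightarrow> bool" where
  "rational_cone \<sigma> \<longleftrightarrow>
     (\<exists>B. finite B \<and> (\<forall>b\<in>B. \<forall>j. b $ j \<in> \<int>) \<and> \<sigma> = convex_cone hull B)"

definition complete_rational_fan :: "(real^'n) set set \<Rightarrow> bool" where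
  "complete_rational_fan \<Delta> \<longleftrightarrow>
     polyhedral_fan {0} \<Delta> \<and> complete_fan \<Delta> \<and> (\<forall>\<sigma>\<in>\<Delta>. rational_cone \<sigma>)"

abbreviation real_matrix :: "int^'k^'n \<Rightarrow> real^'k^'n" where
  "real_matrix V \<equiv> map_matrix real_of_int V"

definition ray_matrix :: "(real^'n) set set \<Rightarrow> int^'k^'n \<Rightarrow> bool" where
  "ray_matrix \<Delta> V \<longleftrightarrow>
     bij_betw (\<lambda>i. convex_cone hull {column i (real_matrix V)}) UNIV {\<rho>\<in>\<Delta>. aff_dim \<rho> = 1} \<and>
     (\<forall>i. Gcd (range (\<lambda>j. column i V $ j)) = 1)"

definition ker :: "int^'k^'n \<Rightarrow> (real^'k) set" where
  "ker V = {y. real_matrix V *v y = 0}"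

text \<open>
  For a set \<open>B\<close>, linear independence modulo the subspace \<open>L\<close> (with distinct elements of \<open>B\<close> having
  distinct classes) amounts to \<open>B\<close> being independent with \<open>span B \<inter> L = {0}\<close>.
\<close>

definition simplicial_generators :: "'a::euclidean_space set \<Rightarrow> 'a set \<Rightarrow> 'a set \<Rightarrow> bool" where
  "simplicial_generators L \<sigma> B \<longleftrightarrow>
     finite B \<and> independent B \<and> span B \<inter> L = {0} \<and> \<sigma> = convex_cone hull (B \<union> L)"

definition simplicial_fan :: "'a::euclidean_space set \<Rightarrow> 'a set set \<Rightarrow> bool" where
  "simplicial_fan L \<F> \<longleftrightarrow>
     polyhedral_fan L \<F> \<and> (\<forall>\<sigma>\<in>\<F>. \<exists>B. simplicial_generators L \<sigma> B)"

definition fan_cones :: "'a::euclidean_space set \<Rightarrow> 'a set set \<Rightarrow> nat \<Rightarrow> 'a set set" where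
  "fan_cones L \<F> d = {\<sigma>\<in>\<F>. aff_dim \<sigma> = int (d + dim L)}"

definition fan_refines :: "'a set set \<Rightarrow> 'a set set \<Rightarrow> bool" where
  "fan_refines \<F> \<G> \<longleftrightarrow> \<Union>\<F> = \<Union>\<G> \<and> (\<forall>\<sigma>\<in>\<F>. \<exists>\<tau>\<in>\<G>. \<sigma> \<subseteq> \<tau>)"

definition max_face :: "'a::real_inner set \<Rightarrow> 'a \<Rightarrow> 'a set" where
  "max_face P y = {\<nu>\<in>P. \<forall>\<mu>\<in>P. y \<bullet> \<mu> \<le> y \<bullet> \<nu>}"

definition normal_fan :: "'a::euclidean_space set \<Rightarrow> 'a set set" where
  "normal_fan P = {{y. F \<subseteq> max_face P y} | F. F face_of P \<and> F \<noteq> {}}"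


section \<open>Cox ring elements, Newton polytopes and tropicalizations\<close>

type_synonym 'k cox_poly = "('k \<Rightarrow>\<^sub>0 nat) \<Rightarrow>\<^sub>0 complex"

text \<open>
  The degree of the monomial with exponent \<open>m\<close> is the class of \<open>m\<close> in the cokernel of the
  transpose of \<open>V\<close>, given as a coset.
\<close>

definition cox_degree :: "int^'k^'n \<Rightarrow> ('k \<Rightarrow>\<^sub>0 nat) \<Rightarrow> (int^'k) set" where
  "cox_degree V m = {(\<chi> i. int (Poly_Mapping.lookup m i)) + transpose V *v u | u. True}"

definition cox_homogeneous :: "int^'k^'n \<Rightarrow> (int^'k) set \<Rightarrow> 'k cox_poly \<Rightarrow> bool" where
  "cox_homogeneous V \<alpha> f \<longleftrightarrow> (\<forall>m\<in>Poly_Mapping.keys f. cox_degree V m = \<alpha>)"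

definition positive_coeffs :: "'k cox_poly \<Rightarrow> bool" where
  "positive_coeffs f \<longleftrightarrow>
     (\<forall>m\<in>Poly_Mapping.keys f. \<exists>c>0. Poly_Mapping.lookup f m = complex_of_real c)"

definition newton_polytope :: "('k::finite) cox_poly \<Rightarrow> (real^'k) set" where
  "newton_polytope f =
     convex hull ((\<lambda>m. \<chi> i. real (Poly_Mapping.lookup m i)) ` Poly_Mapping.keys f)"

definition tropicalization :: "('k::finite) cox_poly \<Rightarrow> real^'k \<Rightarrow> real" where
  "tropicalization f x =
     Max ((\<lambda>m. \<Prod>i\<in>UNIV. x $ i ^ Poly_Mapping.lookup m i) ` Poly_Mapping.keys f)"


section \<open>The positive part of the toric variety and its canonical form\<close>

definition pos_orthant :: "(real^'k) set" where
  "pos_orthant = {x. \<forall>i. 0 < x $ i}"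

definition cox_map :: "int^'k^'n \<Rightarrow> 'a::field^'k \<Rightarrow> 'a^'n" where
  "cox_map V x = (\<chi> j. \<Prod>i\<in>UNIV. x $ i powi (column i V $ j))"

text \<open>
  The positive part lies in the real points of the dense torus, so it is described in the torus
  coordinates \<open>t\<^sub>j\<close>.
\<close>

definition X_pos :: "int^'k^'n \<Rightarrow> (real^'n) set" where
  "X_pos V = cox_map V ` pos_orthant"

definition Exp_map :: "int^'k^'n \<Rightarrow> real^'k \<Rightarrow> real^'n" where
  "Exp_map V y = cox_map V (\<chi> i. exp (y $ i))"

text \<open>
  The value at \<open>x\<close>, on the tangent vectors \<open>U\<close>, of the form given by the sum over \<open>|I| = n\<close> of
  \<open>det V\<^sub>I\<close> times the wedge product of the \<open>dx\<^sub>i / x\<^sub>i\<close> for \<open>i \<in> I\<close>. The enumeration \<open>e\<close> of \<open>I\<close> orders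
  both the columns of \<open>V\<^sub>I\<close> and the wedge product, so the term does not depend on its choice.
\<close>

definition canonical_form :: "int^'k^'n \<Rightarrow> real^'k \<Rightarrow> ('n \<Rightarrow> real^'k) \<Rightarrow> real" where
  "canonical_form V x U =
     (\<Sum>I | card I = CARD('n).
        let e = (SOME e. bij_betw e (UNIV::'n set) I) in
          det (\<chi> j m. real_of_int (V $ j $ e m)) * det (\<chi> m l. U l $ e m / x $ e m))"

text \<open>
  The wedge product of the \<open>dt\<^sub>j / t\<^sub>j\<close>. The lemma \<open>canonical_form_pullback\<close> below shows that its
  pullback along \<open>cox_map V\<close> is \<open>canonical_form V\<close>: it is the canonical form viewed on the toric
  variety.
\<close>

definition torus_form :: "real^'n \<Rightarrow> ('n \<Rightarrow> real^'n) \<Rightarrow> real" where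
  "torus_form t U = det (\<chi> j l. U l $ j / t $ j)"

text \<open>
  Integration against the canonical form over the positive part, oriented such that the form is
  positive: the density is the absolute value of the form on the coordinate frame. It is a measure
  on the ambient space \<open>\<real>\<^sup>n\<close>, concentrated on the positive part.
\<close>

definition canonical_measure :: "int^'k^'n \<Rightarrow> (real^'n) measure" where
  "canonical_measure V =
     density lborel (\<lambda>t. indicator (X_pos V) t * ennreal \<bar>torus_form t (\<lambda>l. axis l 1)\<bar>)"

text \<open>The function on the positive part whose value is that of the quotient on the Cox fibre.\<close>

definition trop_ratio ::
  "int^'k^'n \<Rightarrow> ('k::finite) cox_poly \<Rightarrow> 'k cox_poly \<Rightarrow> real^'n \<Rightarrow> real" where
  "trop_ratio V f g t =
     the_elem ((\<lambda>x. tropicalization f x / tropicalization g x) `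
       {x\<in>pos_orthant. cox_map V x = t})"

definition trop_integral ::
  "int^'k^'n \<Rightarrow> ('k::finite) cox_poly \<Rightarrow> 'k cox_poly \<Rightarrow> (real^'n) set \<Rightarrow> ennreal" where
  "trop_integral V f g A = (\<integral>\<^sup>+t\<in>A. ennreal (trop_ratio V f g t) \<partial>canonical_measure V)"

definition trop_measure ::
  "int^'k^'n \<Rightarrow> ('k::finite) cox_poly \<Rightarrow> 'k cox_poly \<Rightarrow> (real^'n) measure" where
  "trop_measure V f g =
     density (canonical_measure V)
       (\<lambda>t. ennreal (trop_ratio V f g t) / trop_integral V f g (X_pos V))"


section \<open>The sampling procedure\<close>

text \<open>The joint law of the two independent draws: the cone \<open>\<sigma>\<close> and the point \<open>q\<close> of the unit cube.\<close>

definition draw_measure ::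
  "int^'k^'n \<Rightarrow> ('k::finite) cox_poly \<Rightarrow> 'k cox_poly \<Rightarrow> (real^'k) set set \<Rightarrow>
     ((real^'k) set \<times> (real^'n)) measure" where
  "draw_measure V f g \<F> =
     point_measure (fan_cones (ker V) \<F> CARD('n))
       (\<lambda>\<sigma>. trop_integral V f g (Exp_map V ` \<sigma>) / trop_integral V f g (X_pos V))
     \<Otimes>\<^sub>M uniform_measure lborel (cbox 0 1)"

definition cox_sample :: "('n \<Rightarrow> real^'k) \<Rightarrow> real^'k \<Rightarrow> real^'n \<Rightarrow> real^'k" where
  "cox_sample w \<delta> q = (\<chi> i. \<Prod>l\<in>UNIV. q $ l powr (- (w l $ i) / (w l \<bullet> \<delta>)))"

definition sampler_output ::
  "int^'k^'n \<Rightarrow> ((real^'k) set \<Rightarrow> 'n \<Rightarrow> real^'k) \<Rightarrow> ((real^'k) set \<Rightarrow> real^'k) \<Rightarrow>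
     (real^'k) set \<times> (real^'n) \<Rightarrow> real^'n" where
  "sampler_output V w \<delta> = (\<lambda>(\<sigma>, q). cox_map V (cox_sample (w \<sigma>) (\<delta> \<sigma>) q))"


section \<open>The canonical form is the pullback of the torus form\<close>

lemma det_rows_sum:
  fixes a :: "'n \<Rightarrow> 'k::finite \<Rightarrow> real^'n"
  shows "det (\<chi> j. \<Sum>i\<in>UNIV. a j i) = (\<Sum>s\<in>UNIV. det (\<chi> j. a j (s j)))"
proof -
  have "(\<Prod>j\<in>UNIV. \<Sum>i\<in>UNIV. a j i $ p j) = (\<Sum>s\<in>UNIV. \<Prod>j\<in>UNIV. a j (s j) $ p j)" for p
    using prod_sum_PiE[of "UNIV::'n set" "\<lambda>_. UNIV::'k set" "\<lambda>j i. a j i $ p j"]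
    by (simp add: PiE_UNIV_domain)
  then show ?thesis
    by (simp add: det_def sum_distrib_left, subst sum.swap, simp)
qed

lemma cauchy_binet:
  fixes A :: "real^'k^'n" and B :: "real^'n^'k" and e :: "'k set \<Rightarrow> 'n \<Rightarrow> 'k"
  assumes e: "\<And>I. card I = CARD('n) \<Longrightarrow> bij_betw (e I) UNIV I"
  shows "det (A ** B) =
    (\<Sum>I | card I = CARD('n). det (\<chi> j m. A $ j $ e I m) * det (\<chi> m l. B $ e I m $ l))"
proof -
  let ?P = "{p. p permutes (UNIV::'n set)}"
  let ?C = "{I::'k set. card I = CARD('n)}"
  let ?t = "\<lambda>s. (\<Prod>j\<in>UNIV. A $ j $ s j) * det (\<chi> j. B $ s j)"
  have AB: "A ** B = (\<chi> j. \<Sum>i\<in>UNIV. A $ j $ i *s B $ i)"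
    by (simp add: matrix_matrix_mult_def vec_eq_iff)
  have "det (A ** B) = (\<Sum>s | \<forall>j. s j \<in> UNIV. det (\<chi> j. A $ j $ s j *s B $ s j))"
    unfolding AB by (simp add: det_rows_sum)
  also have "\<dots> = (\<Sum>s\<in>(UNIV::('n \<Rightarrow> 'k) set). ?t s)"
    by (simp add: det_rows_mul)
  also have "\<dots> = (\<Sum>s | inj s. ?t s)"
  proof (rule sum.mono_neutral_right)
    show "\<forall>s\<in>UNIV - {s. inj s}. ?t s = 0"
    proof
      fix s :: "'n \<Rightarrow> 'k" assume "s \<in> UNIV - {s. inj s}"
      then obtain a b where ab: "a \<noteq> b" "s a = s b" by (auto simp: inj_def)
      have "det (\<chi> j. B $ s j) = 0"
        by (rule det_identical_rows[OF ab(1)]) (simp add: row_def ab(2))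
      then show "?t s = 0" by simp
    qed
  qed auto
  also have "\<dots> = (\<Sum>(I, p)\<in>?C \<times> ?P. ?t (e I \<circ> p))"
  proof (rule sum.reindex_bij_witness[symmetric,
        where j = "\<lambda>(I, p). e I \<circ> p"
          and i = "\<lambda>s. (range s, \<lambda>m. inv_into UNIV (e (range s)) (s m))"])
    fix a assume "a \<in> ?C \<times> ?P"
    then obtain I p where a: "a = (I, p)" and I: "card I = CARD('n)" and p: "bij p"
      by (auto simp: permutes_bij)
    have eI: "bij_betw (e I) UNIV I" using e[OF I] .
    then have inj: "inj (e I)" and ran: "range (e I) = I" by (auto simp: bij_betw_def)
    have r: "range (e I \<circ> p) = I"
      using ran bij_is_surj[OF p] by (simp only: image_comp[symmetric])
    show "(range (case a of (I, p) \<Rightarrow> e I \<circ> p),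
        \<lambda>m. inv_into UNIV (e (range (case a of (I, p) \<Rightarrow> e I \<circ> p)))
              ((case a of (I, p) \<Rightarrow> e I \<circ> p) m)) = a"
      unfolding a prod.case r by (simp add: inv_f_f[OF inj])
    show "(case a of (I, p) \<Rightarrow> e I \<circ> p) \<in> {s. inj s}"
      using inj bij_is_inj[OF p] by (simp add: a inj_compose)
    show "?t (case a of (I, p) \<Rightarrow> e I \<circ> p) = (case a of (I, p) \<Rightarrow> ?t (e I \<circ> p))"
      by (simp add: a)
  next
    fix s :: "'n \<Rightarrow> 'k" assume "s \<in> {s. inj s}"
    then have inj: "inj s" by simp
    have card: "card (range s) = CARD('n)" using inj by (simp add: card_image)
    from e[OF this] have b: "inj (e (range s))" "range (e (range s)) = range s"
      by (auto simp: bij_betw_def)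
    have f: "e (range s) (inv_into UNIV (e (range s)) (s m)) = s m" for m
      by (rule f_inv_into_f) (simp add: b(2))
    show "(case (range s, \<lambda>m. inv_into UNIV (e (range s)) (s m)) of (I, p) \<Rightarrow> e I \<circ> p) = s"
      by (simp add: fun_eq_iff f)
    have "inj (\<lambda>m. inv_into UNIV (e (range s)) (s m))"
      by (rule injI) (metis f inj injD)
    then have "(\<lambda>m. inv_into UNIV (e (range s)) (s m)) permutes UNIV"
      by (intro bij_imp_permutes) (auto simp: bij_def finite_UNIV_inj_surj)
    then show "(range s, \<lambda>m. inv_into UNIV (e (range s)) (s m)) \<in> ?C \<times> ?P"
      using card by simp
  qed
  also have "\<dots> = (\<Sum>I\<in>?C. \<Sum>p\<in>?P. ?t (e I \<circ> p))"
    by (simp add: sum.cartesian_product)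
  also have "\<dots> = (\<Sum>I\<in>?C. det (\<chi> j m. A $ j $ e I m) * det (\<chi> m l. B $ e I m $ l))"
  proof (rule sum.cong[OF refl])
    fix I
    have *: "det (\<chi> j. B $ e I (p j)) = of_int (sign p) * det (\<chi> m l. B $ e I m $ l)"
      if "p permutes UNIV" for p
      using det_permute_rows[OF that, of "\<chi> m. B $ e I m"] by simp
    show "(\<Sum>p\<in>?P. ?t (e I \<circ> p)) =
      det (\<chi> j m. A $ j $ e I m) * det (\<chi> m l. B $ e I m $ l)"
      by (simp add: det_def[of "\<chi> j m. A $ j $ e I m"] sum_distrib_left sum_distrib_right * ac_simps)
  qed
  finally show ?thesis .
qed

lemma has_derivative_cox_map:
  fixes x :: "real^'k" and V :: "int^'k^'n"
  assumes "x \<in> pos_orthant"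
  shows "(cox_map V has_derivative
    (\<lambda>u. \<chi> j. cox_map V x $ j * (\<Sum>i\<in>UNIV. real_of_int (V $ j $ i) * (u $ i / x $ i)))) (at x)"
proof -
  have nz: "x $ i \<noteq> 0" for i using assms by (auto simp: pos_orthant_def less_le)
  have d: "((\<lambda>x. \<Prod>i\<in>UNIV. x $ i powi (V $ j $ i)) has_derivative
      (\<lambda>u. \<Sum>i\<in>UNIV. (u $ i * (of_int (V $ j $ i) * x $ i powi (V $ j $ i - 1))) *
         (\<Prod>m\<in>UNIV - {i}. x $ m powi (V $ j $ m)))) (at x)" for j
    by (rule has_derivative_prod)
      (auto intro!: has_derivative_power_int bounded_linear.has_derivative[OF bounded_linear_vec_nth]
        simp: nz)
  have "((\<lambda>x. \<Prod>i\<in>UNIV. x $ i powi (V $ j $ i)) has_derivative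
      (\<lambda>u. (\<Prod>i\<in>UNIV. x $ i powi (V $ j $ i)) *
        (\<Sum>i\<in>UNIV. real_of_int (V $ j $ i) * (u $ i / x $ i)))) (at x)" for j
  proof (rule has_derivative_eq_rhs[OF d], rule ext)
    fix u :: "real^'k"
    have p: "(\<Prod>m\<in>UNIV. x $ m powi (V $ j $ m)) =
        x $ i powi (V $ j $ i) * (\<Prod>m\<in>UNIV - {i}. x $ m powi (V $ j $ m))" for i
      by (simp add: prod.remove)
    show "(\<Sum>i\<in>UNIV. (u $ i * (of_int (V $ j $ i) * x $ i powi (V $ j $ i - 1))) *
         (\<Prod>m\<in>UNIV - {i}. x $ m powi (V $ j $ m))) =
      (\<Prod>i\<in>UNIV. x $ i powi (V $ j $ i)) *
        (\<Sum>i\<in>UNIV. real_of_int (V $ j $ i) * (u $ i / x $ i))"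
      unfolding sum_distrib_left
    proof (rule sum.cong[OF refl])
      fix i
      show "(u $ i * (of_int (V $ j $ i) * x $ i powi (V $ j $ i - 1))) *
          (\<Prod>m\<in>UNIV - {i}. x $ m powi (V $ j $ m)) =
        (\<Prod>i\<in>UNIV. x $ i powi (V $ j $ i)) * (real_of_int (V $ j $ i) * (u $ i / x $ i))"
        unfolding p[of i] by (simp add: power_int_diff nz field_simps)
    qed
  qed
  then show ?thesis
    unfolding cox_map_def column_def 
    by (subst has_derivative_componentwise_within) (auto simp: Basis_vec_def inner_axis)
qed

lemma canonical_form_pullback:
  fixes x :: "real^'k" and V :: "int^'k^'n"
  assumes "x \<in> pos_orthant"
  shows "canonical_form V x U =
    torus_form (cox_map V x) (\<lambda>l. frechet_derivative (cox_map V) (at x) (U l))"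
proof -
  define e where "e = (\<lambda>I::'k set. SOME e. bij_betw e (UNIV::'n set) I)"
  have e: "bij_betw (e I) UNIV I" if "card I = CARD('n)" for I
    unfolding e_def using that
    by (intro someI_ex[of "\<lambda>e. bij_betw e UNIV I"] finite_same_card_bij) auto
  have nz: "cox_map V x $ j \<noteq> 0" for j
    using assms by (auto simp: cox_map_def pos_orthant_def less_le)
  have "torus_form (cox_map V x) (\<lambda>l. frechet_derivative (cox_map V) (at x) (U l)) =
      det (real_matrix V ** (\<chi> i l. U l $ i / x $ i))"
    unfolding torus_form_def frechet_derivative_at[OF has_derivative_cox_map[OF assms], symmetric]
    by (simp add: nz matrix_matrix_mult_def map_matrix_def)
  also have "\<dots> = (\<Sum>I | card I = CARD('n).
      det (\<chi> j m. real_matrix V $ j $ e I m) *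
      det (\<chi> m l. (\<chi> i l. U l $ i / x $ i) $ e I m $ l))"
    by (rule cauchy_binet) (rule e)
  also have "\<dots> = canonical_form V x U"
    unfolding canonical_form_def Let_def by (simp add: e_def)
  finally show ?thesis by simp
qed

end

theory Submission
  imports Defs
begin

text \<open>
  The proof works in logarithmic coordinates. Homogeneity and \<open>dim \<N>(g) = n\<close> make \<open>V\<close> surjective
  (\<open>surj_real_matrix\<close>), so the positive part is the whole open orthant and its canonical measure is
  the Haar measure of the multiplicative group. Under the map \<open>u \<mapsto> exp u\<close> it corresponds to a multiple of Lebesgue
  measure (\<open>nn_integral_mult_haar_vexp\<close>). The tropicalization of \<open>f\<close> at \<open>exp y\<close> is the exponential of the support
  function of the Newton polytope of \<open>f\<close>, so the ratio of the tropicalizations at the point \<open>exp (V y)\<close> is \<open>exp (h\<^sub>f(y) - h\<^sub>g(y))\<close>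
  (\<open>trop_ratio_vexp\<close>). On a cone \<open>\<sigma>\<close> the exponent is the linear function \<open>- y \<bullet> \<delta>\<^sub>\<sigma>\<close>, and \<open>w\<^sub>l \<bullet> \<delta>\<^sub>\<sigma> > 0\<close> because
  \<open>\<N>(f)\<close> lies in the relative interior of \<open>\<N>(g)\<close> (\<open>inner_less_of_rel_interior\<close>).

  For a point \<open>q = exp s\<close> of the cube, the output has logarithmic coordinate \<open>T s\<close> with \<open>T\<close> linear,
  bijective, and mapping \<open>s \<le> 0\<close> onto the image of \<open>\<sigma>\<close>. In the coordinate \<open>s\<close> the uniform law has density
  \<open>exp (\<Sum> s\<^sub>l)\<close> up to a constant, and this is also the value of the tropical ratio at \<open>T s\<close>. Hence the
  output for the cone \<open>\<sigma>\<close> has the density of \<open>f\<^sup>t\<^sup>r / g\<^sup>t\<^sup>r\<close> on \<open>Exp(\<sigma>)\<close> up to a constant (\<open>cone_sampler\<close>),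
  which can only be the inverse of the integral over \<open>Exp(\<sigma>)\<close>. The probability with which \<open>\<sigma>\<close> is drawn cancels
  that integral. Since the sets \<open>Exp(\<sigma>)\<close> tile the positive part up to null sets (\<open>AE_unique_cone\<close>), summing over
  the cones gives the claim.

  Neither change of variables needs a Jacobian. Both image measures are translation invariant, hence
  multiples of Lebesgue measure by the uniqueness of Haar measure
  (\<open>translation_invariant_distr_eq_lborel\<close>), and normalization determines the constants.
\<close>

section \<open>Uniqueness of translation-invariant measures\<close>

text \<open>
  This is the uniqueness of Haar measure on a Euclidean space. Write \<open>\<mu>\<close> for the image measure and
  \<open>A\<close> for the unit ball. Integrating \<open>1\<^sub>A(x) 1\<^sub>B(y + x)\<close> over \<open>x\<close> (Lebesgue) and \<open>y\<close> (\<open>\<mu>\<close>) in both orders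
  and moving the shift from one variable to the other gives
  \<open>\<lambda>(A) \<mu>(B) = \<lambda>(B) \<mu>(-A) = \<lambda>(B) \<mu>(A)\<close>. The integrals over \<open>\<mu>\<close> are taken over \<open>M\<close>, so only \<open>M\<close> has to be
  \<open>\<sigma>\<close>-finite, and the constant may be \<open>\<infinity>\<close>.
\<close>

lemma translation_invariant_distr_eq_lborel:
  fixes T :: "'b \<Rightarrow> 'a::euclidean_space"
  assumes "sigma_finite_measure M" and T[measurable]: "T \<in> borel_measurable M"
    and inv: "\<And>a. distr (distr M borel T) borel ((+) a) = distr M borel T"
  shows "\<exists>c. distr M borel T = density lborel (\<lambda>_. c)"
proof -
  interpret M: sigma_finite_measure M by fact
  interpret P: pair_sigma_finite M "lborel :: 'a measure" ..
  let ?\<mu> = "distr M borel T" and ?A = "cball 0 1 :: 'a set"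
  define c where "c = emeasure ?\<mu> ?A / emeasure lborel ?A"
  have shift: "(\<integral>\<^sup>+s. h (T s + a) \<partial>M) = (\<integral>\<^sup>+s. h (T s) \<partial>M)"
    if [measurable]: "h \<in> borel_measurable borel" for h :: "'a \<Rightarrow> ennreal" and a
  proof -
    have "(\<integral>\<^sup>+s. h (T s) \<partial>M) = (\<integral>\<^sup>+x. h x \<partial>distr ?\<mu> borel ((+) a))"
      by (simp add: inv nn_integral_distr)
    then show ?thesis by (simp add: nn_integral_distr add.commute)
  qed
  have "emeasure ?\<mu> B = emeasure (density lborel (\<lambda>_. c)) B" if "B \<in> sets ?\<mu>" for B
  proof -
    have B[measurable]: "B \<in> sets borel" using that by simp
    have A[measurable]: "?A \<in> sets borel" by simp
    have mu: "emeasure ?\<mu> C = (\<integral>\<^sup>+s. indicator C (T s) \<partial>M)" if "C \<in> sets borel" for C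
      using that by (simp add: nn_integral_distr flip: nn_integral_indicator)
    have "emeasure lborel ?A * emeasure ?\<mu> B =
        (\<integral>\<^sup>+x. indicator ?A x * (\<integral>\<^sup>+s. indicator B (T s) \<partial>M) \<partial>lborel)"
      using mu[OF B] by (simp add: nn_integral_multc)
    also have "\<dots> = (\<integral>\<^sup>+x. indicator ?A x * (\<integral>\<^sup>+s. indicator B (T s + x) \<partial>M) \<partial>lborel)"
      by (simp add: shift)
    also have "\<dots> = (\<integral>\<^sup>+x. (\<integral>\<^sup>+s. indicator ?A x * indicator B (T s + x) \<partial>M) \<partial>lborel)"
      by (simp add: nn_integral_cmult)
    also have "\<dots> = (\<integral>\<^sup>+s. (\<integral>\<^sup>+x. indicator ?A x * indicator B (T s + x) \<partial>lborel) \<partial>M)"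
      by (rule P.Fubini'[where f="\<lambda>s x. indicator ?A x * indicator B (T s + x)"]) measurable
    also have "\<dots> = (\<integral>\<^sup>+s. (\<integral>\<^sup>+x. indicator ?A (x - T s) * indicator B x \<partial>lborel) \<partial>M)"
    proof (rule nn_integral_cong)
      fix s
      have "(\<integral>\<^sup>+x. indicator ?A (x - T s) * indicator B x \<partial>lborel) =
        (\<integral>\<^sup>+x. indicator ?A (x - T s) * indicator B x \<partial>distr lborel borel ((+) (T s)))"
        by (simp add: lborel_distr_plus)
      then show "(\<integral>\<^sup>+x. indicator ?A x * indicator B (T s + x) \<partial>lborel) =
        (\<integral>\<^sup>+x. indicator ?A (x - T s) * indicator B x \<partial>lborel)"
        by (simp add: nn_integral_distr)
    qed
    also have "\<dots> = (\<integral>\<^sup>+x. (\<integral>\<^sup>+s. indicator ?A (x - T s) * indicator B x \<partial>M) \<partial>lborel)"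
      by (rule P.Fubini'[where f="\<lambda>s x. indicator ?A (x - T s) * indicator B x", symmetric]) measurable
    also have "\<dots> = (\<integral>\<^sup>+x. (\<integral>\<^sup>+s. indicator ?A (T s + - x) \<partial>M) * indicator B x \<partial>lborel)"
    proof (rule nn_integral_cong)
      fix x :: 'a
      \<comment> \<open>the symmetry of the ball replaces the invariance under negation\<close>
      have "indicator ?A (x - T s) = (indicator ?A (T s + - x) :: ennreal)" for s
        by (simp add: indicator_def norm_minus_commute)
      then show "(\<integral>\<^sup>+s. indicator ?A (x - T s) * indicator B x \<partial>M) =
          (\<integral>\<^sup>+s. indicator ?A (T s + - x) \<partial>M) * indicator B x"
        by (simp add: nn_integral_multc)
    qed
    also have "\<dots> = (\<integral>\<^sup>+x. emeasure ?\<mu> ?A * indicator B x \<partial>lborel)"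
      by (subst shift) (simp_all add: mu)
    also have "\<dots> = emeasure ?\<mu> ?A * emeasure lborel B"
      by (simp add: nn_integral_cmult)
    finally have eq: "emeasure lborel ?A * emeasure ?\<mu> B = emeasure ?\<mu> ?A * emeasure lborel B" .
    have fin: "emeasure lborel ?A \<noteq> \<infinity>" using emeasure_lborel_cball_finite[of "0::'a" 1] by simp
    have "ball 0 1 \<subseteq> ?A" by auto
    have pos: "emeasure lborel ?A \<noteq> 0"
    proof
      assume "emeasure lborel ?A = 0"
      then have "emeasure lborel (ball (0::'a) 1) = 0"
        using emeasure_mono[OF \<open>ball 0 1 \<subseteq> ?A\<close>, of lborel] by simp
      then have "negligible (ball (0::'a) 1)"
        by (simp add: negligible_iff_emeasure0 lmeasurable_ball fmeasurableD)
      then show False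
        using open_not_negligible[of "ball (0::'a) 1"] by simp
    qed
    have "emeasure ?\<mu> B = c * emeasure lborel B"
      using eq fin pos unfolding c_def
      by (metis (no_types, lifting) ennreal_mult_divide_eq ennreal_times_divide mult.commute infinity_ennreal_def)
    then show ?thesis by (simp add: emeasure_density nn_integral_cmult)
  qed
  then show ?thesis by (intro exI[of _ c] measure_eqI) auto
qed

section \<open>Logarithmic coordinates on the positive orthant\<close>

definition vexp :: "real^'n \<Rightarrow> real^'n" where
  "vexp u = (\<chi> j. exp (u $ j))"

definition vln :: "real^'n \<Rightarrow> real^'n" where
  "vln t = (\<chi> j. ln (t $ j))"

lemma vexp_in_pos_orthant [simp]: "vexp u \<in> pos_orthant"
  by (simp add: vexp_def pos_orthant_def)

lemma vln_vexp [simp]: "vln (vexp u) = u"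
  by (simp add: vexp_def vln_def)

lemma vexp_vln: "t \<in> pos_orthant \<Longrightarrow> vexp (vln t) = t"
  by (simp add: vexp_def vln_def pos_orthant_def vec_eq_iff)

lemma inj_vexp: "inj vexp"
  by (metis injI vln_vexp)

lemma range_vexp: "range vexp = pos_orthant"
  by (auto intro: vexp_vln[symmetric])

lemma borel_measurable_vec_lambda:
  fixes F :: "'b \<Rightarrow> 'm::finite \<Rightarrow> real"
  assumes "\<And>j. (\<lambda>x. F x j) \<in> borel_measurable M"
  shows "(\<lambda>x. (\<chi> j. F x j) :: real^'m) \<in> borel_measurable M"
proof (subst borel_measurable_euclidean_space, intro ballI)
  fix b :: "real^'m" assume "b \<in> Basis"
  then obtain i where "b = axis i 1" by (auto simp: Basis_vec_def)
  then show "(\<lambda>x. (\<chi> j. F x j) \<bullet> b) \<in> borel_measurable M"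
    using assms by (simp add: inner_axis)
qed

lemma borel_measurable_vec_nth' [measurable (raw)]:
  "f \<in> borel_measurable M \<Longrightarrow> (\<lambda>x. (f x :: real^'n) $ i) \<in> borel_measurable M"
  by (simp add: cart_eq_inner_axis)

lemma vexp_borel [measurable]: "vexp \<in> borel_measurable borel"
  unfolding vexp_def by (rule borel_measurable_vec_lambda) measurable

lemma vln_borel [measurable]: "vln \<in> borel_measurable borel"
  unfolding vln_def by (rule borel_measurable_vec_lambda) measurable

lemma pos_orthant_borel [measurable]: "pos_orthant \<in> sets borel"
proof -
  have "pos_orthant = {x \<in> space borel. \<forall>i. 0 < (x::real^'n) $ i}" by (simp add: pos_orthant_def)
  also have "\<dots> \<in> sets borel" by measurable
  finally show ?thesis .
qed

text \<open>
  The measure of the form that is the wedge product of the \<open>dt\<^sub>j / t\<^sub>j\<close>: the Haar measure of the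
  multiplicative group of the open orthant.
\<close>

definition mult_haar :: "(real^'n) measure" where
  "mult_haar = density lborel (\<lambda>t. indicator pos_orthant t * ennreal (\<Prod>j\<in>UNIV. 1 / t $ j))"

lemma space_mult_haar [simp]: "space mult_haar = UNIV"
  and sets_mult_haar [measurable_cong, simp]: "sets mult_haar = sets borel"
  by (simp_all add: mult_haar_def)

lemma nn_integral_mult_haar:
  assumes [measurable]: "h \<in> borel_measurable borel"
  shows "(\<integral>\<^sup>+t. h t \<partial>mult_haar) =
    (\<integral>\<^sup>+t. indicator pos_orthant t * ennreal (\<Prod>j\<in>UNIV. 1 / t $ j) * h t \<partial>lborel)"
  unfolding mult_haar_def by (subst nn_integral_density) measurable

text \<open>
  Scaling by \<open>exp a\<close> multiplies Lebesgue measure by \<open>\<Prod> exp a\<^sub>j\<close>, and the density \<open>\<Prod> 1 / t\<^sub>j\<close> by the inverse.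
\<close>

lemma mult_haar_scale_invariant:
  fixes h :: "real^'n \<Rightarrow> ennreal"
  assumes [measurable]: "h \<in> borel_measurable borel"
  shows "(\<integral>\<^sup>+t. h (vexp a * t) \<partial>mult_haar) = (\<integral>\<^sup>+t. h t \<partial>mult_haar)"
proof -
  define c where "c = (\<lambda>b::real^'n. exp (a \<bullet> b))"
  let ?F = "\<lambda>t. indicator pos_orthant t * ennreal (\<Prod>j\<in>UNIV. 1 / t $ j) * h t"
  have [measurable]: "(\<lambda>t. vexp a * t) \<in> borel_measurable (borel :: (real^'n) measure)"
    unfolding times_vec_def by (rule borel_measurable_vec_lambda) measurable
  have T: "(0 + (\<Sum>b\<in>Basis. (c b * (t \<bullet> b)) *\<^sub>R b)) = vexp a * t" for t
  proof (rule euclidean_eqI)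
    fix b :: "real^'n" assume b: "b \<in> Basis"
    then have "(0 + (\<Sum>b\<in>Basis. (c b * (t \<bullet> b)) *\<^sub>R b)) \<bullet> b = c b * (t \<bullet> b)"
      by simp
    also have "\<dots> = (vexp a * t) \<bullet> b"
      using b by (auto simp: Basis_vec_def inner_axis c_def vexp_def)
    finally show "(0 + (\<Sum>b\<in>Basis. (c b * (t \<bullet> b)) *\<^sub>R b)) \<bullet> b = (vexp a * t) \<bullet> b" .
  qed
  have D: "(\<Prod>b\<in>(Basis::(real^'n) set). \<bar>c b\<bar>) = (\<Prod>j\<in>UNIV. exp (a $ j))"
  proof -
    have B: "(Basis::(real^'n) set) = (\<lambda>j. axis j 1) ` UNIV" by (auto simp: Basis_vec_def)
    have "inj (\<lambda>j::'n. axis j (1::real))" by (simp add: inj_def axis_eq_axis)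
    then show ?thesis
      unfolding B by (subst prod.reindex) (simp_all add: c_def inner_axis)
  qed
  have lb: "lborel = density (distr lborel borel (\<lambda>t. vexp a * t)) (\<lambda>_. ennreal (\<Prod>j\<in>UNIV. exp (a $ j)))"
  proof -
    have "c b \<noteq> 0" for b by (simp add: c_def)
    then show ?thesis using lborel_affine_euclidean[of c 0] unfolding T D by blast
  qed
  have "(\<integral>\<^sup>+t. h t \<partial>mult_haar) = (\<integral>\<^sup>+t. ?F t \<partial>lborel)"
    by (rule nn_integral_mult_haar) measurable
  also have "\<dots> = (\<integral>\<^sup>+t. ennreal (\<Prod>j\<in>UNIV. exp (a $ j)) * ?F (vexp a * t) \<partial>lborel)"
    by (subst lb) (simp add: nn_integral_density nn_integral_distr)
  also have "\<dots> = (\<integral>\<^sup>+t. indicator pos_orthant t * ennreal (\<Prod>j\<in>UNIV. 1 / t $ j) * h (vexp a * t) \<partial>lborel)"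
  proof (rule nn_integral_cong)
    fix t :: "real^'n"
    have "ennreal (\<Prod>j\<in>UNIV. exp (a $ j)) * ennreal (\<Prod>j\<in>UNIV. 1 / (vexp a * t) $ j) =
        ennreal (\<Prod>j\<in>UNIV. 1 / t $ j)" if "t \<in> pos_orthant"
      using that
      by (subst ennreal_mult[symmetric])
        (auto simp: vexp_def pos_orthant_def less_imp_le prod_nonneg prod.distrib[symmetric])
    moreover have "vexp a * t \<in> pos_orthant \<longleftrightarrow> t \<in> pos_orthant"
      by (simp add: vexp_def pos_orthant_def zero_less_mult_iff)
    ultimately show "ennreal (\<Prod>j\<in>UNIV. exp (a $ j)) * ?F (vexp a * t) =
        indicator pos_orthant t * ennreal (\<Prod>j\<in>UNIV. 1 / t $ j) * h (vexp a * t)"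
      by (simp add: indicator_def flip: mult.assoc)
  qed
  also have "\<dots> = (\<integral>\<^sup>+t. h (vexp a * t) \<partial>mult_haar)"
    by (rule nn_integral_mult_haar[symmetric]) measurable
  finally show ?thesis by simp
qed

lemma sigma_finite_mult_haar: "sigma_finite_measure (mult_haar :: (real^'n) measure)"
  unfolding mult_haar_def
  by (subst sigma_finite_measure.sigma_finite_iff_density_finite[OF sigma_finite_lborel]) (auto simp: ennreal_mult_eq_top_iff indicator_def)

lemma AE_mult_haar_pos: "AE t in mult_haar. t \<in> pos_orthant"
  unfolding mult_haar_def by (subst AE_density) (auto simp: indicator_def)

text \<open>
  The logarithm turns the scaling invariance into translation invariance, so that the image measure
  is a multiple of Lebesgue measure. The multiple is \<open>1\<close>, but its value cancels from every
  probability below.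
\<close>

theorem nn_integral_mult_haar_vexp:
  "\<exists>c. \<forall>h\<in>borel_measurable borel.
     (\<integral>\<^sup>+t. h t \<partial>(mult_haar :: (real^'n) measure)) = c * (\<integral>\<^sup>+u. h (vexp u) \<partial>lborel)"
proof -
  have vln_vexp_times: "vln (vexp a * t) = a + vln t" if "t \<in> pos_orthant" for a t :: "real^'n"
    using that by (simp add: vln_def vexp_def pos_orthant_def vec_eq_iff ln_mult_pos)
  let ?L = "distr (mult_haar :: (real^'n) measure) borel vln"
  have "distr ?L borel ((+) a) = ?L" for a
  proof (rule measure_eqI)
    fix B :: "(real^'n) set" assume "B \<in> sets (distr ?L borel ((+) a))"
    then have [measurable]: "B \<in> sets borel" by simp
    have "emeasure (distr ?L borel ((+) a)) B = (\<integral>\<^sup>+t. indicator B (a + vln t) \<partial>mult_haar)"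
      by (simp add: nn_integral_distr flip: nn_integral_indicator)
    also have "\<dots> = (\<integral>\<^sup>+t. indicator B (vln (vexp a * t)) \<partial>mult_haar)"
      by (rule nn_integral_cong_AE, use AE_mult_haar_pos in eventually_elim)
        (simp add: vln_vexp_times)
    also have "\<dots> = (\<integral>\<^sup>+t. indicator B (vln t) \<partial>mult_haar)"
      by (rule mult_haar_scale_invariant) measurable
    also have "\<dots> = emeasure ?L B"
      by (simp add: nn_integral_distr flip: nn_integral_indicator)
    finally show "emeasure (distr ?L borel ((+) a)) B = emeasure ?L B" .
  qed simp
  then obtain c where c: "?L = density lborel (\<lambda>_. c)"
    using translation_invariant_distr_eq_lborel[OF sigma_finite_mult_haar, of vln] by auto
  have "(\<integral>\<^sup>+t. h t \<partial>(mult_haar :: (real^'n) measure)) = c * (\<integral>\<^sup>+u. h (vexp u) \<partial>lborel)"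
    if [measurable]: "h \<in> borel_measurable borel" for h
  proof -
    have "(\<integral>\<^sup>+t. h t \<partial>mult_haar) = (\<integral>\<^sup>+t. h (vexp (vln t)) \<partial>mult_haar)"
      by (rule nn_integral_cong_AE, use AE_mult_haar_pos in eventually_elim)
        (simp add: vexp_vln)
    also have "\<dots> = (\<integral>\<^sup>+u. h (vexp u) \<partial>?L)" by (simp add: nn_integral_distr)
    also have "\<dots> = c * (\<integral>\<^sup>+u. h (vexp u) \<partial>lborel)"
      unfolding c by (simp add: nn_integral_density nn_integral_cmult)
    finally show ?thesis .
  qed
  then show ?thesis by blast
qed

section \<open>Tropicalizations as support functions\<close>

abbreviation exponent :: "('k::finite \<Rightarrow>\<^sub>0 nat) \<Rightarrow> real^'k" where
  "exponent m \<equiv> \<chi> i. real (Poly_Mapping.lookup m i)"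

text \<open>
  The support function of the Newton polytope, evaluated on the exponents.
\<close>

definition support_value :: "('k::finite) cox_poly \<Rightarrow> real^'k \<Rightarrow> real" where
  "support_value f y = Max ((\<lambda>m. exponent m \<bullet> y) ` Poly_Mapping.keys f)"

lemma cox_map_vexp: "cox_map V (vexp y) = vexp (real_matrix V *v y)"
proof -
  have "(\<Prod>i\<in>UNIV. exp (y $ i) powi (V $ j $ i)) =
      exp (\<Sum>i\<in>UNIV. real_of_int (V $ j $ i) * y $ i)" for j
    by (simp add: exp_sum exp_power_int)
  then show ?thesis
    by (simp add: cox_map_def vexp_def column_def matrix_vector_mult_def map_matrix_def)
qed

lemma Exp_map_eq: "Exp_map V y = vexp (real_matrix V *v y)"
  using cox_map_vexp[of V y] by (simp add: Exp_map_def vexp_def)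

lemma tropicalization_vexp:
  assumes "f \<noteq> 0"
  shows "tropicalization f (vexp y) = exp (support_value f y)"
proof -
  have "(\<Prod>i\<in>UNIV. exp (y $ i) ^ Poly_Mapping.lookup m i) = exp (exponent m \<bullet> y)" for m
    by (simp add: inner_vec_def exp_sum exp_of_nat_mult)
  then have "tropicalization f (vexp y) =
      Max (exp ` (\<lambda>m. exponent m \<bullet> y) ` Poly_Mapping.keys f)"
    by (simp add: tropicalization_def vexp_def image_image)
  also have "\<dots> = exp (support_value f y)"
    unfolding support_value_def
    by (rule mono_Max_commute[symmetric]) (use assms in \<open>auto simp: mono_def\<close>)
  finally show ?thesis .
qed

text \<open>
  Monomials of the same degree differ by an element of the row space of \<open>V\<close>, which is orthogonal to
  \<open>ker V\<close>. This is the reason why the quotient of two tropicalizations descends to the toric variety.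
\<close>

lemma exponent_diff:
  assumes "cox_degree V m = cox_degree V m'"
  shows "\<exists>u. exponent m = exponent m' + u v* real_matrix V"
proof -
  have "(\<chi> i. int (Poly_Mapping.lookup m i)) + transpose V *v 0 \<in> cox_degree V m"
    unfolding cox_degree_def by blast
  then obtain u where
    u: "(\<chi> i. int (Poly_Mapping.lookup m i)) = (\<chi> i. int (Poly_Mapping.lookup m' i)) + transpose V *v u"
    unfolding assms by (auto simp: cox_degree_def)
  have "real (Poly_Mapping.lookup m i) = real (Poly_Mapping.lookup m' i) +
      (\<Sum>j\<in>UNIV. real_of_int (u $ j) * real_of_int (V $ j $ i))" for i
  proof -
    have "int (Poly_Mapping.lookup m i) = int (Poly_Mapping.lookup m' i) + (\<Sum>j\<in>UNIV. u $ j * V $ j $ i)"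
      using arg_cong[OF u, of "\<lambda>v. v $ i"] by (simp add: vector_matrix_mult_def mult.commute)
    then have "real_of_int (int (Poly_Mapping.lookup m i)) =
        real_of_int (int (Poly_Mapping.lookup m' i) + (\<Sum>j\<in>UNIV. u $ j * V $ j $ i))"
      by simp
    then show ?thesis by simp
  qed
  then have "exponent m = exponent m' + (\<chi> j. real_of_int (u $ j)) v* real_matrix V"
    by (simp add: vec_eq_iff vector_matrix_mult_def map_matrix_def mult.commute)
  then show ?thesis by blast
qed

lemma exponent_inner_ker:
  assumes "cox_degree V m = cox_degree V m'" "z \<in> ker V"
  shows "exponent m \<bullet> z = exponent m' \<bullet> z"
proof -
  obtain u where "exponent m = exponent m' + u v* real_matrix V"
    using exponent_diff[OF assms(1)] by blast
  then show ?thesis using assms(2) by (simp add: inner_add_left dot_lmul_matrix ker_def)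
qed

lemma support_value_add_ker:
  assumes "f \<noteq> 0" and deg: "\<And>m. m \<in> Poly_Mapping.keys f \<Longrightarrow> cox_degree V m = cox_degree V m0"
    and z: "z \<in> ker V"
  shows "support_value f (y + z) = support_value f y + exponent m0 \<bullet> z"
proof -
  have "(\<lambda>m. exponent m \<bullet> (y + z)) ` Poly_Mapping.keys f =
      (\<lambda>r. r + exponent m0 \<bullet> z) ` (\<lambda>m. exponent m \<bullet> y) ` Poly_Mapping.keys f"
    unfolding image_image
    by (rule image_cong) (simp_all add: inner_add_right exponent_inner_ker[OF deg z])
  then show ?thesis
    unfolding support_value_def
    by (simp, subst mono_Max_commute[symmetric]) (use assms(1) in \<open>auto simp: mono_def\<close>)
qed

text \<open>
  A linear functional has the same maximum on a finite set and on its convex hull.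
\<close>

lemma support_value_eq_max_face:
  assumes "f \<noteq> 0" "\<nu> \<in> max_face (newton_polytope f) y"
  shows "support_value f y = \<nu> \<bullet> y"
proof (rule antisym)
  let ?E = "exponent ` Poly_Mapping.keys f"
  have nu: "\<nu> \<in> convex hull ?E" "\<And>\<mu>. \<mu> \<in> convex hull ?E \<Longrightarrow> y \<bullet> \<mu> \<le> y \<bullet> \<nu>"
    using assms(2) by (auto simp: max_face_def newton_polytope_def)
  have "exponent m \<bullet> y \<le> \<nu> \<bullet> y" if "m \<in> Poly_Mapping.keys f" for m
    using nu(2)[of "exponent m"] hull_subset[of ?E convex] that by (auto simp: inner_commute)
  then show "support_value f y \<le> \<nu> \<bullet> y"
    unfolding support_value_def using assms(1) by (subst Max_le_iff) auto
  have "?E \<subseteq> {x. y \<bullet> x \<le> support_value f y}"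
    unfolding support_value_def by (auto simp: inner_commute intro!: Max_ge)
  then have "convex hull ?E \<subseteq> {x. y \<bullet> x \<le> support_value f y}"
    by (rule hull_minimal) (rule convex_halfspace_le)
  then show "\<nu> \<bullet> y \<le> support_value f y"
    using nu(1) by (auto simp: inner_commute)
qed

lemma support_value_borel [measurable]:
  assumes "F \<in> borel_measurable M"
  shows "(\<lambda>x. support_value f (F x)) \<in> borel_measurable M"
  unfolding support_value_def by (rule borel_measurable_Max) (use assms in auto)

section \<open>Newton polytopes and cones\<close>

text \<open>
  By homogeneity the Newton polytope lies in a translate of the row space of \<open>V\<close>. The row space has
  dimension at most \<open>n\<close>, so a polytope of dimension \<open>n\<close> spans it.
\<close>

lemma span_newton_polytope:
  fixes V :: "int^'k^'n"
  assumes deg: "cox_homogeneous V \<alpha> g" and m: "m \<in> Poly_Mapping.keys g"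
    and dim: "aff_dim (newton_polytope g) = int CARD('n)"
  shows "span ((\<lambda>x. x - exponent m) ` newton_polytope g) = range (\<lambda>u. u v* real_matrix V)"
    and "dim (range (\<lambda>u. u v* real_matrix V)) = CARD('n)"
proof -
  let ?R = "range (\<lambda>u. u v* real_matrix V)" and ?p = "exponent m"
  let ?Q = "(\<lambda>x. x - ?p) ` newton_polytope g"
  have R: "?R = range ((*v) (transpose (real_matrix V)))" by simp
  have sub: "subspace ?R" unfolding R by (rule linear_subspace_image[OF matrix_vector_mul_linear subspace_UNIV])
  have "newton_polytope g \<subseteq> (+) ?p ` ?R"
    unfolding newton_polytope_def
  proof (rule hull_minimal)
    show "exponent ` Poly_Mapping.keys g \<subseteq> (+) ?p ` ?R"
    proof safe
      fix m' assume m': "m' \<in> Poly_Mapping.keys g"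
      then have "cox_degree V m' = cox_degree V m"
        using deg m by (simp add: cox_homogeneous_def)
      from exponent_diff[OF this] show "exponent m' \<in> (+) ?p ` ?R" by blast
    qed
    show "convex ((+) ?p ` ?R)"
      using subspace_imp_convex[OF sub] by (simp only: convex_translation)
  qed
  then have QR: "?Q \<subseteq> ?R" by auto
  have pN: "?p \<in> newton_polytope g"
    unfolding newton_polytope_def by (rule hull_inc) (use m in blast)
  have "int (dim ?Q) = aff_dim ?Q"
    by (rule aff_dim_zero[symmetric], rule hull_inc) (use pN in \<open>auto simp: image_iff\<close>)
  also have "\<dots> = int CARD('n)"
    using dim aff_dim_translation_eq[of "- ?p" "newton_polytope g"] by simp
  finally have dQ: "dim ?Q = CARD('n)" by simp
  have "dim ?R \<le> CARD('n)"
    unfolding R using rank_bound[of "transpose (real_matrix V)"] by (simp only: rank_dim_range)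
  with dQ QR show "dim ?R = CARD('n)" using dim_subset[OF QR] by simp
  with dQ have "span ?Q = span ?R" by (intro dim_eq_span[OF QR]) simp
  then show "span ?Q = ?R" using sub by (simp add: span_eq_iff)
qed

lemma constant_on_newton_polytope_imp_ker:
  fixes V :: "int^'k^'n"
  assumes deg: "cox_homogeneous V \<alpha> g" and g: "g \<noteq> 0"
    and dim: "aff_dim (newton_polytope g) = int CARD('n)"
    and const: "\<And>x. x \<in> newton_polytope g \<Longrightarrow> y \<bullet> x = b"
  shows "y \<in> ker V"
proof -
  obtain m where m: "m \<in> Poly_Mapping.keys g" using g by fastforce
  let ?Q = "(\<lambda>x. x - exponent m) ` newton_polytope g"
  have "exponent m \<in> newton_polytope g"
    unfolding newton_polytope_def by (rule hull_inc) (use m in blast)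
  then have "?Q \<subseteq> {x. y \<bullet> x = 0}" by (auto simp: inner_diff_right const)
  then have "span ?Q \<subseteq> {x. y \<bullet> x = 0}" by (rule span_minimal) (rule subspace_hyperplane)
  then have "y \<bullet> (u v* real_matrix V) = 0" for u
    unfolding span_newton_polytope(1)[OF deg m dim] by blast
  then have "u \<bullet> (real_matrix V *v y) = 0" for u
    using dot_lmul_matrix[of u "real_matrix V" y] by (simp add: inner_commute)
  then show ?thesis by (metis (mono_tags) inner_eq_zero_iff ker_def mem_Collect_eq)
qed

text \<open>
  The row space has dimension \<open>n\<close> and \<open>ker V\<close> is its orthogonal complement.
\<close>

lemma surj_real_matrix:
  fixes V :: "int^'k^'n"
  assumes deg: "cox_homogeneous V \<alpha> g" and g: "g \<noteq> 0"
    and dim: "aff_dim (newton_polytope g) = int CARD('n)"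
  shows "surj ((*v) (real_matrix V))"
    and "dim (ker V) + CARD('n) = CARD('k)"
proof -
  obtain m where m: "m \<in> Poly_Mapping.keys g" using g by fastforce
  let ?R = "range (\<lambda>u. u v* real_matrix V)"
  have R: "?R = range ((*v) (transpose (real_matrix V)))" by simp
  have dR: "dim ?R = CARD('n)" by (rule span_newton_polytope[OF deg m dim])
  then have "rank (real_matrix V) = CARD('n)"
    unfolding R by (simp only: rank_dim_range[symmetric] rank_transpose)
  then show "surj ((*v) (real_matrix V))" by (simp only: full_rank_surjective)
  have "ker V = {y \<in> UNIV. \<forall>x\<in>?R. orthogonal x y}"
    by (auto simp: ker_def orthogonal_def dot_lmul_matrix) (metis inner_eq_zero_iff)
  moreover have "subspace ?R" unfolding R by (rule linear_subspace_image[OF matrix_vector_mul_linear subspace_UNIV])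
  ultimately show "dim (ker V) + CARD('n) = CARD('k)"
    using dim_subspace_orthogonal_to_vectors[of ?R UNIV] dR by simp
qed

text \<open>
  This gives the positivity of the numbers \<open>w\<^sub>l \<bullet> \<delta>\<^sub>\<sigma>\<close>. A linear functional that attains its maximum at a relative
  interior point is constant on the polytope, which for the polytope of \<open>g\<close> forces it into \<open>ker V\<close>.
\<close>

lemma inner_less_of_rel_interior:
  fixes V :: "int^'k^'n"
  assumes deg: "cox_homogeneous V \<alpha> g" and g: "g \<noteq> 0"
    and dim: "aff_dim (newton_polytope g) = int CARD('n)"
    and a: "a \<in> rel_interior (newton_polytope g)" and b: "b \<in> max_face (newton_polytope g) y"
    and y: "y \<notin> ker V"
  shows "y \<bullet> a < y \<bullet> b"
proof (rule ccontr)
  assume *: "\<not> y \<bullet> a < y \<bullet> b"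
  let ?N = "newton_polytope g"
  have le: "y \<bullet> x \<le> y \<bullet> b" if "x \<in> ?N" for x using b that by (simp add: max_face_def)
  have aN: "a \<in> ?N" using a rel_interior_subset by blast
  have "convex ?N" by (simp add: newton_polytope_def)
  then have F: "(?N \<inter> {x. y \<bullet> x = y \<bullet> b}) face_of ?N"
    by (rule face_of_Int_supporting_hyperplane_le) (rule le)
  have "a \<in> ?N \<inter> {x. y \<bullet> x = y \<bullet> b}" using aN le[OF aN] * by auto
  then have "?N \<inter> {x. y \<bullet> x = y \<bullet> b} = ?N"
    using face_of_disjoint_rel_interior[OF F] a by blast
  then have "y \<in> ker V"
    by (intro constant_on_newton_polytope_imp_ker[OF deg g dim, of y "y \<bullet> b"]) blast
  with y show False ..
qed

text \<open>
  The vectors maximized at a fixed \<open>\<nu>\<close> form a closed set, so the condition passes from the relative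
  interior to the whole cone.
\<close>

lemma max_face_closure_rel_interior:
  fixes P :: "'a::euclidean_space set"
  assumes "convex \<sigma>" "\<sigma> \<noteq> {}" and max: "\<And>y. y \<in> rel_interior \<sigma> \<Longrightarrow> \<nu> \<in> max_face P y"
    and y: "y \<in> \<sigma>"
  shows "\<nu> \<in> max_face P y"
proof -
  have "rel_interior \<sigma> \<noteq> {}" using assms by (simp add: rel_interior_eq_empty)
  then have nu: "\<nu> \<in> P" using max by (auto simp: max_face_def)
  have "closed (\<Inter>\<mu>\<in>P. {z. (\<mu> - \<nu>) \<bullet> z \<le> 0})"
    by (intro closed_INT ballI closed_halfspace_le)
  moreover have "rel_interior \<sigma> \<subseteq> (\<Inter>\<mu>\<in>P. {z. (\<mu> - \<nu>) \<bullet> z \<le> 0})"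
  proof (intro subsetI INT_I CollectI)
    fix z \<mu> assume "z \<in> rel_interior \<sigma>" "\<mu> \<in> P"
    then have "z \<bullet> \<mu> \<le> z \<bullet> \<nu>" using max by (auto simp: max_face_def)
    then show "(\<mu> - \<nu>) \<bullet> z \<le> 0" by (simp add: inner_diff_left inner_commute[of z])
  qed
  ultimately have "closure (rel_interior \<sigma>) \<subseteq> (\<Inter>\<mu>\<in>P. {z. (\<mu> - \<nu>) \<bullet> z \<le> 0})"
    by (intro closure_minimal)
  then have "y \<in> (\<Inter>\<mu>\<in>P. {z. (\<mu> - \<nu>) \<bullet> z \<le> 0})"
    using y closure_subset by (auto simp: convex_closure_rel_interior[OF \<open>convex \<sigma>\<close>])
  then show ?thesis using nu by (simp add: max_face_def inner_diff_left inner_commute[of y])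
qed

lemma convex_cone_sum:
  assumes "convex_cone S" "finite A" "\<And>i. i \<in> A \<Longrightarrow> f i \<in> S"
  shows "sum f A \<in> S"
  using assms(2,3)
  by (induction A rule: finite_induct)
    (auto simp: convex_cone_contains_0[OF assms(1)] intro: convex_cone_add[OF assms(1)])

lemma convex_cone_hull_range_Un_subspace:
  fixes w :: "'n::finite \<Rightarrow> 'a::real_vector"
  assumes L: "subspace L"
  shows "convex_cone hull (range w \<union> L) = {(\<Sum>l\<in>UNIV. c l *\<^sub>R w l) + z | c z. (\<forall>l. 0 \<le> c l) \<and> z \<in> L}"
    (is "_ = ?C")
proof (rule antisym)
  show "convex_cone hull (range w \<union> L) \<subseteq> ?C"
  proof (rule hull_minimal)
    have "w m \<in> ?C" for m
      using subspace_0[OF L]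
      by (intro CollectI exI[of _ "\<lambda>l. if l = m then 1 else 0"] exI[of _ 0])
        (simp add: if_distrib[of "\<lambda>c. c *\<^sub>R _"] cong: if_cong)
    moreover have "z \<in> ?C" if "z \<in> L" for z
      using that by (intro CollectI exI[of _ "\<lambda>_. 0"] exI[of _ z]) simp
    ultimately show "range w \<union> L \<subseteq> ?C" by blast
    show "convex_cone ?C"
      unfolding convex_cone_iff
    proof (intro conjI ballI allI impI)
      show "0 \<in> ?C" using subspace_0[OF L] by (intro CollectI exI[of _ "\<lambda>_. 0"] exI[of _ 0]) simp
    next
      fix x y assume "x \<in> ?C" "y \<in> ?C"
      then obtain c z c' z' where *: "x = (\<Sum>l\<in>UNIV. c l *\<^sub>R w l) + z" "\<forall>l. 0 \<le> c l" "z \<in> L"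
        "y = (\<Sum>l\<in>UNIV. c' l *\<^sub>R w l) + z'" "\<forall>l. 0 \<le> c' l" "z' \<in> L" by blast
      then show "x + y \<in> ?C"
        by (intro CollectI exI[of _ "\<lambda>l. c l + c' l"] exI[of _ "z + z'"])
          (simp add: scaleR_add_left sum.distrib subspace_add[OF L])
    next
      fix x and a :: real assume "x \<in> ?C" "0 \<le> a"
      then obtain c z where *: "x = (\<Sum>l\<in>UNIV. c l *\<^sub>R w l) + z" "\<forall>l. 0 \<le> c l" "z \<in> L" by blast
      then show "a *\<^sub>R x \<in> ?C" using \<open>0 \<le> a\<close>
        by (intro CollectI exI[of _ "\<lambda>l. a * c l"] exI[of _ "a *\<^sub>R z"])
          (simp add: scaleR_add_right scaleR_sum_right subspace_scale[OF L])
    qed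
  qed
  show "?C \<subseteq> convex_cone hull (range w \<union> L)"
  proof
    fix x assume "x \<in> ?C"
    then obtain c z where *: "x = (\<Sum>l\<in>UNIV. c l *\<^sub>R w l) + z" "\<forall>l. 0 \<le> c l" "z \<in> L" by blast
    have cc: "convex_cone (convex_cone hull (range w \<union> L))" by (rule convex_cone_convex_cone_hull)
    have "w l \<in> convex_cone hull (range w \<union> L)" "z \<in> convex_cone hull (range w \<union> L)" for l
      using * by (auto intro: hull_inc)
    then show "x \<in> convex_cone hull (range w \<union> L)"
      unfolding * using *
      by (intro convex_cone_add[OF cc] convex_cone_sum[OF cc] convex_cone_scaleR[OF cc]) auto
  qed
qed

lemma subspace_ker: "subspace (ker V)"
  unfolding ker_def by (rule linear_subspace_kernel) simp

text \<open>
  A set that contains \<open>ker V\<close> and is mapped by \<open>V\<close> to a spanning set is itself spanning. Cones of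
  lower dimension, and the intersections of distinct full cones, are therefore null sets downstairs.
\<close>

lemma negligible_cone_image:
  fixes V :: "int^'k^'n" and S :: "(real^'k) set"
  assumes dimK: "dim (ker V) + CARD('n) = CARD('k)" and "ker V \<subseteq> S"
    and "aff_dim S \<noteq> int (CARD('n) + dim (ker V))"
  shows "negligible ((*v) (real_matrix V) ` S)"
proof (rule negligible_lowdim, rule ccontr)
  let ?A = "(*v) (real_matrix V)"
  assume "\<not> dim (?A ` S) < DIM(real^'n)"
  then have "span (?A ` S) = UNIV" using dim_eq_full dim_subset_UNIV le_antisym not_less by metis
  then have im: "?A ` span S = UNIV" by (simp add: linear_span_image)
  have "x \<in> span S" for x
  proof -
    obtain y where "y \<in> span S" "?A y = ?A x" using im by (metis UNIV_I imageE)
    then have "x - y \<in> ker V" by (simp add: ker_def matrix_vector_mult_diff_distrib)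
    then have "x - y \<in> span S" using assms(2) span_base by blast
    then show ?thesis using \<open>y \<in> span S\<close> by (metis diff_add_cancel span_add)
  qed
  then have "span S = UNIV" by blast
  then have "dim S = CARD('k)" by (metis DIM_cart DIM_real dim_eq_full mult.right_neutral)
  moreover have "0 \<in> S" using assms(2) subspace_0[OF subspace_ker] by blast
  ultimately show False using assms(1,3) by (simp add: aff_dim_zero hull_inc)
qed

section \<open>The canonical measure, the tropical ratio and the unit cube\<close>

lemma canonical_measure_eq_mult_haar:
  fixes V :: "int^'k^'n"
  assumes "surj ((*v) (real_matrix V))"
  shows "X_pos V = pos_orthant" and "canonical_measure V = mult_haar"
proof -
  have "cox_map V ` range vexp = vexp ` range ((*v) (real_matrix V))"
    by (simp add: image_image cox_map_vexp)
  then show X: "X_pos V = pos_orthant" by (simp add: X_pos_def assms range_vexp)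
  have "indicator pos_orthant t * ennreal \<bar>torus_form t (\<lambda>l. axis l 1)\<bar> =
      indicator pos_orthant t * ennreal (\<Prod>j\<in>UNIV. 1 / t $ j)" for t :: "real^'n"
  proof -
    have "torus_form t (\<lambda>l. axis l 1) = (\<Prod>j\<in>UNIV. 1 / t $ j)"
      unfolding torus_form_def by (subst det_diagonal) (auto simp: axis_def)
    moreover have "0 \<le> (\<Prod>j\<in>UNIV. 1 / t $ j)" if "t \<in> pos_orthant"
      using that by (intro prod_nonneg) (simp add: pos_orthant_def less_imp_le)
    ultimately show ?thesis by (simp add: indicator_def)
  qed
  then show "canonical_measure V = mult_haar"
    unfolding canonical_measure_def mult_haar_def X by simp
qed

text \<open>
  The Cox fibre over the point \<open>exp (V y)\<close> is \<open>exp (y + ker V)\<close>, and a shift by \<open>z \<in> ker V\<close> changes both support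
  functions by the same amount.
\<close>

lemma trop_ratio_vexp:
  fixes V :: "int^'k^'n"
  assumes "f \<noteq> 0" "g \<noteq> 0" "cox_homogeneous V \<alpha> f" "cox_homogeneous V \<alpha> g"
  shows "trop_ratio V f g (vexp (real_matrix V *v y)) = exp (support_value f y - support_value g y)"
proof -
  let ?q = "\<lambda>x. tropicalization f x / tropicalization g x"
  let ?S = "{x \<in> pos_orthant. cox_map V x = vexp (real_matrix V *v y)}"
  obtain m where m: "m \<in> Poly_Mapping.keys f" using \<open>f \<noteq> 0\<close> by fastforce
  have q: "?q x = exp (support_value f y - support_value g y)" if "x \<in> ?S" for x
  proof -
    have x: "x = vexp (vln x)" using that by (simp add: vexp_vln)
    then have "vexp (real_matrix V *v vln x) = vexp (real_matrix V *v y)"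
      using that cox_map_vexp[of V "vln x"] by simp
    then have "real_matrix V *v vln x = real_matrix V *v y" by (simp add: inj_eq[OF inj_vexp])
    then have z: "vln x - y \<in> ker V" by (simp add: ker_def matrix_vector_mult_diff_distrib)
    have "support_value f (y + (vln x - y)) = support_value f y + exponent m \<bullet> (vln x - y)"
      "support_value g (y + (vln x - y)) = support_value g y + exponent m \<bullet> (vln x - y)"
      using assms m
      by (intro support_value_add_ker[OF _ _ z]; simp add: cox_homogeneous_def)+
    then have "support_value f (vln x) - support_value g (vln x) =
        support_value f y - support_value g y" by simp
    then show ?thesis
      using x by (metis assms(1,2) exp_diff tropicalization_vexp)
  qed
  have "?q ` ?S = (\<lambda>_. exp (support_value f y - support_value g y)) ` ?S"
    by (rule image_cong[OF refl q])
  also have "\<dots> = {exp (support_value f y - support_value g y)}"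
    by (rule image_constant[of "vexp y"]) (simp add: cox_map_vexp)
  finally have "?q ` ?S = {exp (support_value f y - support_value g y)}" .
  then show ?thesis by (simp add: trop_ratio_def)
qed

text \<open>
  A linear right inverse of \<open>V\<close> selects one point of each Cox fibre, which makes the ratio a
  composition of measurable maps. Off the positive part the fibre is empty and the value is constant.
\<close>

lemma trop_ratio_borel:
  fixes V :: "int^'k^'n"
  assumes surj: "surj ((*v) (real_matrix V))"
    and fg: "f \<noteq> 0" "g \<noteq> 0" "cox_homogeneous V \<alpha> f" "cox_homogeneous V \<alpha> g"
  shows "trop_ratio V f g \<in> borel_measurable borel"
proof -
  obtain R where R: "linear R" "(*v) (real_matrix V) \<circ> R = id"
    using linear_surjective_right_inverse[OF matrix_vector_mul_linear surj] by blast
  then have AR: "real_matrix V *v R u = u" for u by (metis comp_apply id_apply)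
  have [measurable]: "R \<in> borel_measurable borel"
    using R(1) by (intro borel_measurable_continuous_onI linear_continuous_on)
      (simp add: linear_conv_bounded_linear)
  have "trop_ratio V f g t = (if t \<in> pos_orthant
      then exp (support_value f (R (vln t)) - support_value g (R (vln t))) else the_elem {})" for t
  proof (cases "t \<in> pos_orthant")
    case True
    then have "t = vexp (real_matrix V *v R (vln t))" by (simp add: AR vexp_vln)
    then show ?thesis using True trop_ratio_vexp[OF fg] by metis
  next
    case False
    have "cox_map V x \<in> pos_orthant" if "x \<in> pos_orthant" for x
      using that cox_map_vexp[of V "vln x"] by (simp add: vexp_vln)
    then have empty: "{x \<in> pos_orthant. cox_map V x = t} = {}" using False by blast
    show ?thesis using False unfolding trop_ratio_def empty by simp
  qed
  then have "trop_ratio V f g = (\<lambda>t. if t \<in> pos_orthant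
      then exp (support_value f (R (vln t)) - support_value g (R (vln t))) else the_elem {})" by blast
  also have "\<dots> \<in> borel_measurable borel" by measurable
  finally show ?thesis .
qed

lemma linear_surj_distr_lborel:
  fixes T :: "'a::euclidean_space \<Rightarrow> 'a"
  assumes "linear T" "surj T"
  shows "\<exists>c. distr lborel borel T = density lborel (\<lambda>_. c)"
proof (rule translation_invariant_distr_eq_lborel)
  show "sigma_finite_measure (lborel :: 'a measure)" by (rule sigma_finite_lborel)
  show T: "T \<in> borel_measurable lborel"
    using \<open>linear T\<close> by (simp, intro borel_measurable_continuous_onI linear_continuous_on)
      (simp add: linear_conv_bounded_linear)
  fix a
  obtain b where b: "a = T b" using \<open>surj T\<close> by blast
  have "distr (distr lborel borel T) borel ((+) a) = distr lborel borel ((+) a \<circ> T)"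
    using T by (intro distr_distr) auto
  also have "(+) a \<circ> T = T \<circ> (+) b" by (auto simp: b linear_add[OF \<open>linear T\<close>])
  also have "distr lborel borel (T \<circ> (+) b) = distr (distr lborel borel ((+) b)) borel T"
    using T by (intro distr_distr[symmetric]) auto
  also have "\<dots> = distr lborel borel T" by (simp add: lborel_distr_plus)
  finally show "distr (distr lborel borel T) borel ((+) a) = distr lborel borel T" .
qed

definition unit_cube :: "(real^'n) measure" where
  "unit_cube = uniform_measure lborel (cbox 0 1)"

lemma emeasure_cbox_0_1: "emeasure lborel (cbox (0::real^'n) 1) = 1"
proof -
  have "(b::real^'n) \<in> Basis \<Longrightarrow> 1 \<bullet> b = 1" for b by (auto simp: Basis_vec_def inner_axis)
  then show ?thesis by (simp add: emeasure_lborel_cbox_eq)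
qed

text \<open>
  With \<open>q = exp s\<close> the uniform density \<open>1\<close> becomes \<open>\<Prod> q\<^sub>j\<close> with respect to the multiplicative Haar measure,
  hence \<open>exp (\<Sum> s\<^sub>j)\<close> on the orthant \<open>s \<le> 0\<close>.
\<close>

lemma unit_cube_log:
  fixes h :: "real^'n \<Rightarrow> ennreal"
  assumes c: "\<And>h. h \<in> borel_measurable borel \<Longrightarrow>
     (\<integral>\<^sup>+t. h t \<partial>(mult_haar :: (real^'n) measure)) = c * (\<integral>\<^sup>+u. h (vexp u) \<partial>lborel)"
    and [measurable]: "h \<in> borel_measurable borel"
  shows "(\<integral>\<^sup>+q. h q \<partial>unit_cube) =
    c * (\<integral>\<^sup>+s. h (vexp s) * (indicator {s. \<forall>l. s $ l \<le> 0} s * ennreal (exp (\<Sum>l\<in>UNIV. s $ l))) \<partial>lborel)"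
proof -
  let ?C = "cbox (0::real^'n) 1"
  \<comment> \<open>the faces where a coordinate vanishes have no logarithm, but are null sets\<close>
  have "AE q in lborel. \<forall>l. (q::real^'n) $ l \<noteq> 0"
  proof (rule AE_all_countable[THEN iffD2], rule allI)
    fix l :: 'n
    show "AE q in lborel. (q::real^'n) $ l \<noteq> 0"
      using AE_lborel_inner_neq[of "axis l (1::real)" 0] by (simp add: axis_in_Basis_iff inner_axis)
  qed
  then have *: "AE q in lborel. q \<in> ?C \<longrightarrow> q \<in> pos_orthant"
    by eventually_elim (auto simp: mem_box_cart pos_orthant_def less_le)
  have "(\<integral>\<^sup>+q. h q \<partial>unit_cube) = (\<integral>\<^sup>+q. indicator ?C q * h q \<partial>lborel)"
    unfolding unit_cube_def uniform_measure_def by (simp add: nn_integral_density emeasure_cbox_0_1 divide_ennreal_def)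
  also have "\<dots> = (\<integral>\<^sup>+t. indicator pos_orthant t * ennreal (\<Prod>j\<in>UNIV. 1 / t $ j) *
      (h t * (indicator ?C t * ennreal (\<Prod>j\<in>UNIV. t $ j))) \<partial>lborel)"
  proof (rule nn_integral_cong_AE, use * in eventually_elim)
    case (elim t)
    have "ennreal (\<Prod>j\<in>UNIV. 1 / t $ j) * ennreal (\<Prod>j\<in>UNIV. t $ j) = 1" if "t \<in> pos_orthant"
    proof -
      have "(\<Prod>j\<in>UNIV. 1 / t $ j) * (\<Prod>j\<in>UNIV. t $ j) = 1"
        unfolding prod.distrib[symmetric] using that by (intro prod.neutral) (auto simp: pos_orthant_def less_le)
      then show ?thesis
        using that by (subst ennreal_mult[symmetric]) (auto intro!: prod_nonneg simp: pos_orthant_def less_imp_le)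
    qed
    then show ?case using elim by (auto simp: indicator_def ac_simps)
  qed
  also have "\<dots> = (\<integral>\<^sup>+t. h t * (indicator ?C t * ennreal (\<Prod>j\<in>UNIV. t $ j)) \<partial>mult_haar)"
    by (rule nn_integral_mult_haar[symmetric]) measurable
  also have "\<dots> = c * (\<integral>\<^sup>+s. h (vexp s) * (indicator ?C (vexp s) * ennreal (\<Prod>j\<in>UNIV. vexp s $ j)) \<partial>lborel)"
    by (rule c) measurable
  also have "(\<lambda>s. h (vexp s) * (indicator ?C (vexp s) * ennreal (\<Prod>j\<in>UNIV. vexp s $ j))) =
      (\<lambda>s. h (vexp s) * (indicator {s. \<forall>l. s $ l \<le> 0} s * ennreal (exp (\<Sum>l\<in>UNIV. s $ l))))"
    by (rule ext) (simp add: vexp_def mem_box_cart exp_sum indicator_def)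
  finally show ?thesis .
qed

section \<open>Sampling from one cone\<close>

lemma cox_sample_vexp:
  "cox_sample w \<delta> (vexp s) = vexp (- (\<Sum>l\<in>UNIV. (s $ l / (w l \<bullet> \<delta>)) *\<^sub>R w l))"
proof -
  have "(\<Prod>l\<in>UNIV. exp (s $ l) powr (- (w l $ i) / (w l \<bullet> \<delta>))) =
      exp (- (\<Sum>l\<in>UNIV. s $ l / (w l \<bullet> \<delta>) * w l $ i))" for i
    by (simp add: powr_def flip: exp_sum sum_negf) (simp add: ac_simps)
  then show ?thesis by (simp add: cox_sample_def vexp_def vec_eq_iff sum_component)
qed

text \<open>
  The constant is an argument because \<open>unit_cube_log\<close> has to be used with the same one.
\<close>

lemma trop_integral_log:
  fixes V :: "int^'k^'n"
  assumes surj: "surj ((*v) (real_matrix V))"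
    and fg: "f \<noteq> 0" "g \<noteq> 0" "cox_homogeneous V \<alpha> f" "cox_homogeneous V \<alpha> g"
    and c: "\<And>h. h \<in> borel_measurable borel \<Longrightarrow>
     (\<integral>\<^sup>+t. h t \<partial>(mult_haar :: (real^'n) measure)) = c * (\<integral>\<^sup>+u. h (vexp u) \<partial>lborel)"
    and [measurable]: "E \<in> sets borel"
  shows "trop_integral V f g E =
    c * (\<integral>\<^sup>+u. ennreal (trop_ratio V f g (vexp u)) * indicator E (vexp u) \<partial>lborel)"
proof -
  note [measurable] = trop_ratio_borel[OF surj fg]
  show ?thesis
    unfolding trop_integral_def canonical_measure_eq_mult_haar(2)[OF surj] by (rule c) measurable
qed

text \<open>
  The cone \<open>\<sigma>\<close> contains \<open>ker V\<close>, so its image under \<open>V\<close> is the cone of the \<open>n\<close> linearly independent vectors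
  \<open>V w\<^sub>l\<close>. It is parametrized by the nonpositive orthant because the parameter is the logarithm of a point
  of the unit cube.
\<close>

lemma cone_image:
  fixes V :: "int^'k^'n" and w :: "'n \<Rightarrow> real^'k"
  assumes "inj w" and gen: "simplicial_generators (ker V) \<sigma> (range w)"
    and d: "\<And>l. 0 < d l"
  defines "T \<equiv> (\<lambda>s. real_matrix V *v (- (\<Sum>l\<in>UNIV. (s $ l / d l) *\<^sub>R w l)))"
  shows "linear T" "inj T" "(*v) (real_matrix V) ` \<sigma> = T ` {s. \<forall>l. s $ l \<le> 0}"
proof -
  define W where "W = (\<lambda>s::real^'n. - (\<Sum>l\<in>UNIV. (s $ l / d l) *\<^sub>R w l))"
  have T: "T = (*v) (real_matrix V) \<circ> W" by (auto simp: T_def W_def)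
  have lW: "linear W"
    unfolding W_def
    by (intro linearI)
      (simp_all add: add_divide_distrib scaleR_add_left sum.distrib scaleR_sum_right)
  show lT: "linear T" unfolding T by (intro linear_compose lW) simp
  have ind: "independent (range w)" and K: "span (range w) \<inter> ker V = {0}"
    and sig: "\<sigma> = convex_cone hull (range w \<union> ker V)"
    using gen by (auto simp: simplicial_generators_def)
  show "inj T"
    unfolding linear_injective_0[OF lT]
  proof (intro allI impI)
    fix s assume "T s = 0"
    then have "W s \<in> ker V" by (simp add: T ker_def)
    moreover have "W s \<in> span (range w)"
      unfolding W_def by (intro span_neg span_sum span_scale span_base) simp
    ultimately have "W s = 0" using K by blast
    then have "(\<Sum>l\<in>UNIV. (s $ l / d l) *\<^sub>R w l) = 0" by (simp add: W_def)
    then have "(\<Sum>v\<in>range w. (s $ (inv w v) / d (inv w v)) *\<^sub>R v) = 0"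
      by (simp add: sum.reindex[OF \<open>inj w\<close>] inv_f_f[OF \<open>inj w\<close>])
    then have "s $ (inv w v) / d (inv w v) = 0" if "v \<in> range w" for v
      using independentD[OF ind finite_imageI[OF finite] subset_refl,
          of "\<lambda>v. s $ (inv w v) / d (inv w v)" v] that by simp
    then have "s $ l / d l = 0" for l by (metis inv_f_f[OF \<open>inj w\<close>] rangeI)
    then show "s = 0" using d by (simp add: vec_eq_iff less_le)
  qed
  show "(*v) (real_matrix V) ` \<sigma> = T ` {s. \<forall>l. s $ l \<le> 0}"
    unfolding sig convex_cone_hull_range_Un_subspace[OF subspace_ker]
  proof (intro equalityI subsetI; elim imageE CollectE exE conjE)
    fix u c z x
    assume u: "u = real_matrix V *v x" and x: "x = (\<Sum>l\<in>UNIV. c l *\<^sub>R w l) + z"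
      and c: "\<forall>l. 0 \<le> c l" and z: "z \<in> ker V"
    have nz: "d l \<noteq> 0" for l using d[of l] by simp
    have "u = T (\<chi> l. - (c l * d l))"
      using z by (simp add: u x T W_def ker_def matrix_vector_right_distrib sum_negf nz)
    moreover have "(\<chi> l. - (c l * d l)) \<in> {s. \<forall>l. s $ l \<le> 0}"
      using c d by (simp add: less_imp_le)
    ultimately show "u \<in> T ` {s. \<forall>l. s $ l \<le> 0}" by blast
  next
    fix u s assume u: "u = T s" and s: "\<forall>l. s $ l \<le> (0::real)"
    have "W s \<in> {(\<Sum>l\<in>UNIV. c l *\<^sub>R w l) + z | c z. (\<forall>l. 0 \<le> c l) \<and> z \<in> ker V}"
      using s d
      by (intro CollectI exI[of _ "\<lambda>l. - s $ l / d l"] exI[of _ 0])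
        (simp add: W_def sum_negf subspace_0[OF subspace_ker] less_imp_le divide_nonpos_pos)
    then show "u \<in> (*v) (real_matrix V) ` {(\<Sum>l\<in>UNIV. c l *\<^sub>R w l) + z | c z. (\<forall>l. 0 \<le> c l) \<and> z \<in> ker V}"
      unfolding u T comp_apply by (rule imageI)
  qed
qed

lemma closed_cone_image:
  fixes V :: "int^'k^'n" and w :: "'n \<Rightarrow> real^'k"
  assumes "inj w" and gen: "simplicial_generators (ker V) \<sigma> (range w)"
  shows "closed ((*v) (real_matrix V) ` \<sigma>)"
proof -
  have "closed {s::real^'n. \<forall>l. s $ l \<le> 0}"
    by (intro closed_Collect_all closed_Collect_le continuous_intros)
  then show ?thesis
    unfolding cone_image(3)[OF assms, of "\<lambda>_. 1", simplified]
    by (rule closed_injective_linear_image) (use cone_image(1,2)[OF assms, of "\<lambda>_. 1"] in simp_all)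
qed

lemma Exp_image: "Exp_map V ` \<sigma> = vexp ` (*v) (real_matrix V) ` \<sigma>"
  by (simp add: image_image Exp_map_eq)

lemma vexp_image_borel:
  assumes [measurable]: "D \<in> sets borel"
  shows "vexp ` D \<in> sets borel"
proof -
  have "vexp ` D = {t \<in> space borel. t \<in> pos_orthant \<and> vln t \<in> D}"
    by (auto simp: vexp_vln intro!: image_eqI[where x="vln _"])
  also have "\<dots> \<in> sets borel" by measurable
  finally show ?thesis .
qed

lemma sampler_borel [measurable]:
  fixes V :: "int^'k^'n" and w :: "'m::finite \<Rightarrow> real^'k"
  shows "(\<lambda>q. cox_map V (cox_sample w \<delta> q)) \<in> borel_measurable borel"
proof -
  have 1: "(\<lambda>q. cox_sample w \<delta> q) \<in> borel_measurable borel"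
    unfolding cox_sample_def by (rule borel_measurable_vec_lambda) measurable
  have p: "(\<lambda>x::real. x powi n) \<in> borel_measurable borel" for n
    unfolding power_int_def by measurable
  have 2: "(\<lambda>x::real^'k. \<Prod>i\<in>UNIV. (x $ i) powi n i) \<in> borel_measurable borel" for n
    by (intro borel_measurable_prod measurable_compose[OF _ p]) measurable
  have 3: "(cox_map V :: real^'k \<Rightarrow> real^'n) \<in> borel_measurable borel"
    unfolding cox_map_def by (rule borel_measurable_vec_lambda) (rule 2)
  show ?thesis by (rule measurable_compose[OF 1 3])
qed

text \<open>
  In logarithmic coordinates \<open>q = exp s\<close> the sampling map is the linear isomorphism \<open>T\<close>. At \<open>T s\<close> the tropical
  ratio is \<open>exp (- y \<bullet> \<delta>)\<close> with \<open>y = - \<Sum> (s\<^sub>l / (w\<^sub>l \<bullet> \<delta>)) w\<^sub>l\<close>, that is \<open>exp (\<Sum> s\<^sub>l)\<close>: the division by \<open>w\<^sub>l \<bullet> \<delta>\<close> is there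
  to produce exactly the density of the uniform law in the coordinate \<open>s\<close>. So the law of the output
  is the tropical density on \<open>Exp(\<sigma>)\<close> up to the constant by which \<open>T\<close> scales Lebesgue measure.
\<close>

theorem cone_sampler:
  fixes V :: "int^'k^'n" and w :: "'n \<Rightarrow> real^'k"
  assumes surj: "surj ((*v) (real_matrix V))"
    and fg: "f \<noteq> 0" "g \<noteq> 0" "cox_homogeneous V \<alpha> f" "cox_homogeneous V \<alpha> g"
    and w: "inj w" and gen: "simplicial_generators (ker V) \<sigma> (range w)"
    and d: "\<And>l. 0 < w l \<bullet> \<delta>"
    and \<delta>: "\<And>y. y \<in> \<sigma> \<Longrightarrow> support_value g y - support_value f y = y \<bullet> \<delta>"
  shows "\<exists>c. \<forall>B\<in>sets borel. (\<integral>\<^sup>+q. indicator B (cox_map V (cox_sample w \<delta> q)) \<partial>unit_cube) =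
    c * trop_integral V f g (Exp_map V ` \<sigma> \<inter> B)"
proof -
  define T where "T = (\<lambda>s. real_matrix V *v (- (\<Sum>l\<in>UNIV. (s $ l / (w l \<bullet> \<delta>)) *\<^sub>R w l)))"
  let ?N = "{s::real^'n. \<forall>l. s $ l \<le> 0}" and ?A = "(*v) (real_matrix V)"
  have T: "linear T" "inj T" "?A ` \<sigma> = T ` ?N"
    unfolding T_def by (rule cone_image[OF w gen d])+
  have A[measurable]: "?A ` \<sigma> \<in> sets borel"
    using closed_cone_image[OF w gen] by (rule borel_closed)
  have E[measurable]: "Exp_map V ` \<sigma> \<in> sets borel"
    unfolding Exp_image using A by (rule vexp_image_borel)
  note [measurable] = trop_ratio_borel[OF surj fg]
  have [measurable]: "T \<in> borel_measurable borel"
    using \<open>linear T\<close> by (intro borel_measurable_continuous_onI linear_continuous_on)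
      (simp add: linear_conv_bounded_linear)
  obtain c where c: "\<And>h. h \<in> borel_measurable borel \<Longrightarrow>
     (\<integral>\<^sup>+t. h t \<partial>(mult_haar :: (real^'n) measure)) = c * (\<integral>\<^sup>+u. h (vexp u) \<partial>lborel)"
    using nn_integral_mult_haar_vexp by blast
  obtain c' where c': "distr lborel borel T = density lborel (\<lambda>_. c')"
    using linear_surj_distr_lborel[OF T(1)] linear_inj_imp_surj[OF T(1,2)] by blast
  have ratio: "indicator ?N s * ennreal (exp (\<Sum>l\<in>UNIV. s $ l)) =
      indicator (Exp_map V ` \<sigma>) (vexp (T s)) * ennreal (trop_ratio V f g (vexp (T s)))" for s
  proof (cases "s \<in> ?N")
    case True
    define y where "y = - (\<Sum>l\<in>UNIV. (s $ l / (w l \<bullet> \<delta>)) *\<^sub>R w l)"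
    have Ty: "T s = ?A y" by (simp add: T_def y_def)
    have "T s \<in> ?A ` \<sigma>" unfolding T(3) using True by blast
    have "vexp (T s) \<in> Exp_map V ` \<sigma>" unfolding Exp_image using \<open>T s \<in> ?A ` \<sigma>\<close> by blast
    moreover have "trop_ratio V f g (vexp (T s)) = exp (\<Sum>l\<in>UNIV. s $ l)"
    proof -
      have sig: "\<sigma> = {(\<Sum>l\<in>UNIV. c l *\<^sub>R w l) + z | c z. (\<forall>l. 0 \<le> c l) \<and> z \<in> ker V}"
        using gen convex_cone_hull_range_Un_subspace[OF subspace_ker, of w V]
        by (simp add: simplicial_generators_def)
      have "\<forall>l. 0 \<le> - s $ l / (w l \<bullet> \<delta>)"
        using True d by (simp add: less_imp_le divide_nonpos_pos)
      then have "y \<in> \<sigma>"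
        unfolding sig
        by (intro CollectI exI[of _ "\<lambda>l. - s $ l / (w l \<bullet> \<delta>)"] exI[of _ 0])
          (simp add: y_def sum_negf subspace_0[OF subspace_ker])
      moreover have "y \<bullet> \<delta> = - (\<Sum>l\<in>UNIV. s $ l)"
      proof -
        have "w l \<bullet> \<delta> \<noteq> 0" for l using d[of l] by simp
        then show ?thesis by (simp add: y_def inner_sum_left)
      qed
      ultimately show ?thesis using \<delta>[of y] trop_ratio_vexp[OF fg, of y] by (simp add: Ty)
    qed
    ultimately show ?thesis using True by simp
  next
    case False
    then have "T s \<notin> ?A ` \<sigma>" unfolding T(3) using T(2) by (auto dest: injD)
    then have "vexp (T s) \<notin> Exp_map V ` \<sigma>" unfolding Exp_image by (auto dest: injD[OF inj_vexp])
    then show ?thesis using False by simp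
  qed
  have "(\<integral>\<^sup>+q. indicator B (cox_map V (cox_sample w \<delta> q)) \<partial>unit_cube) =
    c' * trop_integral V f g (Exp_map V ` \<sigma> \<inter> B)" if B[measurable]: "B \<in> sets borel" for B
  proof -
    let ?h = "\<lambda>u. indicator B (vexp u) * (indicator (Exp_map V ` \<sigma>) (vexp u) *
        ennreal (trop_ratio V f g (vexp u)))"
    have "(\<integral>\<^sup>+q. indicator B (cox_map V (cox_sample w \<delta> q)) \<partial>unit_cube) =
      c * (\<integral>\<^sup>+s. indicator B (cox_map V (cox_sample w \<delta> (vexp s))) *
        (indicator ?N s * ennreal (exp (\<Sum>l\<in>UNIV. s $ l))) \<partial>lborel)"
      by (intro unit_cube_log[OF c] measurable_compose[OF sampler_borel] borel_measurable_indicator B)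
    also have "\<dots> = c * (\<integral>\<^sup>+s. ?h (T s) \<partial>lborel)"
      by (simp only: cox_sample_vexp cox_map_vexp ratio T_def)
    also have "(\<integral>\<^sup>+s. ?h (T s) \<partial>lborel) = (\<integral>\<^sup>+u. ?h u \<partial>distr lborel borel T)"
      by (rule nn_integral_distr[symmetric]) measurable
    also have "\<dots> = c' * (\<integral>\<^sup>+u. ?h u \<partial>lborel)"
      unfolding c' by (simp add: nn_integral_density nn_integral_cmult)
    also have "c * (c' * (\<integral>\<^sup>+u. ?h u \<partial>lborel)) = c' * (c * (\<integral>\<^sup>+u. ?h u \<partial>lborel))"
      by (rule mult.left_commute)
    also have "(\<integral>\<^sup>+u. ?h u \<partial>lborel) = (\<integral>\<^sup>+u. ennreal (trop_ratio V f g (vexp u)) *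
        indicator (Exp_map V ` \<sigma> \<inter> B) (vexp u) \<partial>lborel)"
      by (rule nn_integral_cong) (simp add: indicator_def)
    also have "c * \<dots> = trop_integral V f g (Exp_map V ` \<sigma> \<inter> B)"
      by (rule trop_integral_log[OF surj fg c sets.Int[OF E B], symmetric])
    finally show ?thesis .
  qed
  then show ?thesis by blast
qed

section \<open>Assembling the cones\<close>

text \<open>
  The full-dimensional cones tile the quotient by \<open>ker V\<close>: every point lies in some cone, and the
  exceptional points lie in a lower-dimensional cone or in a common proper face of two full ones. Two cones
  have a common point downstairs only if they have one upstairs, since both are stable under \<open>ker V\<close>.
\<close>

lemma AE_unique_cone:
  fixes V :: "int^'k^'n"
  assumes surj: "surj ((*v) (real_matrix V))" and dimK: "dim (ker V) + CARD('n) = CARD('k)"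
    and fan: "polyhedral_fan (ker V) \<F>" and complete: "\<Union>\<F> = UNIV"
  shows "AE u in lborel. \<exists>!\<sigma>. \<sigma> \<in> fan_cones (ker V) \<F> CARD('n) \<and> u \<in> (*v) (real_matrix V) ` \<sigma>"
proof -
  let ?A = "(*v) (real_matrix V)" and ?full = "fan_cones (ker V) \<F> CARD('n)"
  define small where "small = {S. negligible (?A ` S)}"
  have fin: "finite \<F>" using fan by (simp add: polyhedral_fan_def)
  have cone: "convex \<sigma>" "ker V \<subseteq> \<sigma>" "\<And>x z. x \<in> \<sigma> \<Longrightarrow> z \<in> ker V \<Longrightarrow> x + z \<in> \<sigma>"
    if "\<sigma> \<in> \<F>" for \<sigma>
  proof -
    have "\<exists>B. finite B \<and> \<sigma> = convex_cone hull (B \<union> ker V)"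
      using fan \<open>\<sigma> \<in> \<F>\<close> by (simp add: polyhedral_fan_def)
    then obtain B where B: "\<sigma> = convex_cone hull (B \<union> ker V)" by (elim exE conjE)
    show "convex \<sigma>" unfolding B by (rule convex_convex_cone_hull)
    show K: "ker V \<subseteq> \<sigma>" unfolding B by (meson Un_upper2 hull_subset order_trans)
    show "x + z \<in> \<sigma>" if "x \<in> \<sigma>" "z \<in> ker V" for x z
      using that(1) subsetD[OF K that(2)] unfolding B by (rule convex_cone_hull_add)
  qed
  have low: "\<sigma> \<in> small" if "\<sigma> \<in> \<F>" "\<sigma> \<notin> ?full" for \<sigma>
    unfolding small_def mem_Collect_eq
    by (rule negligible_cone_image[OF dimK]) (use that cone in \<open>auto simp: fan_cones_def\<close>)
  have inter: "\<sigma> \<inter> \<tau> \<in> small" if "\<sigma> \<in> ?full" "\<tau> \<in> ?full" "\<sigma> \<noteq> \<tau>" for \<sigma> \<tau>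
    unfolding small_def mem_Collect_eq
  proof (rule negligible_cone_image[OF dimK])
    have F: "\<sigma> \<in> \<F>" "\<tau> \<in> \<F>" using that by (auto simp: fan_cones_def)
    then show "ker V \<subseteq> \<sigma> \<inter> \<tau>" using cone by blast
    have face: "(\<sigma> \<inter> \<tau>) face_of \<sigma>" "(\<sigma> \<inter> \<tau>) face_of \<tau>"
      using fan F by (simp_all add: polyhedral_fan_def)
    have "\<sigma> \<inter> \<tau> \<noteq> \<sigma> \<or> \<sigma> \<inter> \<tau> \<noteq> \<tau>" using that by blast
    then have "aff_dim (\<sigma> \<inter> \<tau>) < aff_dim \<sigma> \<or> aff_dim (\<sigma> \<inter> \<tau>) < aff_dim \<tau>"
      using face face_of_aff_dim_lt cone(1) F by blast
    then show "aff_dim (\<sigma> \<inter> \<tau>) \<noteq> int (CARD('n) + dim (ker V))"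
      using that by (auto simp: fan_cones_def)
  qed
  let ?N = "(\<Union>\<sigma>\<in>\<F> \<inter> small. ?A ` \<sigma>) \<union> (\<Union>(\<sigma>, \<tau>)\<in>{(\<sigma>, \<tau>) \<in> ?full \<times> ?full. \<sigma> \<noteq> \<tau>}. ?A ` (\<sigma> \<inter> \<tau>))"
  have finf: "finite ?full" using fin by (simp add: fan_cones_def)
  have "finite {(\<sigma>, \<tau>) \<in> ?full \<times> ?full. \<sigma> \<noteq> \<tau>}"
    by (rule finite_subset[of _ "?full \<times> ?full"]) (use finf in auto)
  then have "negligible ?N"
    using fin inter by (intro negligible_Un negligible_Union) (auto simp: small_def)
  then have "AE u in lebesgue. u \<notin> ?N" by (intro AE_not_in) (simp add: negligible_iff_null_sets)
  then have "AE u in lborel. u \<notin> ?N" by (simp only: AE_completion_iff)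
  then show ?thesis
  proof eventually_elim
    case (elim u)
    obtain y where y: "u = ?A y" using surj by blast
    obtain \<sigma> where \<sigma>: "\<sigma> \<in> \<F>" "y \<in> \<sigma>" using complete by blast
    show ?case
    proof (rule ex1I[of _ \<sigma>])
      show 1: "\<sigma> \<in> ?full \<and> u \<in> ?A ` \<sigma>"
      proof
        show u: "u \<in> ?A ` \<sigma>" using \<sigma>(2) y by (rule rev_image_eqI)
        show "\<sigma> \<in> ?full"
        proof (rule ccontr)
          assume "\<sigma> \<notin> ?full"
          then have "\<sigma> \<in> \<F> \<inter> small" using low[OF \<sigma>(1)] \<sigma>(1) by simp
          then have "u \<in> ?N" using u by (intro UnI1 UN_I)
          then show False using elim by contradiction
        qed
      qed
      fix \<tau> assume \<tau>: "\<tau> \<in> ?full \<and> u \<in> ?A ` \<tau>"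
      then obtain y' where y': "y' \<in> \<tau>" "u = ?A y'" by blast
      have "\<tau> \<in> \<F>" using \<tau> by (simp add: fan_cones_def)
      moreover have "y - y' \<in> ker V"
        using y y'(2) by (simp add: ker_def matrix_vector_mult_diff_distrib)
      ultimately have "y' + (y - y') \<in> \<tau>" by (rule cone(3)[OF _ y'(1)])
      then have "y \<in> \<sigma> \<inter> \<tau>" using \<sigma> by simp
      then have "u \<in> ?A ` (\<sigma> \<inter> \<tau>)" using y by (rule rev_image_eqI)
      then have "u \<in> ?N" if "\<tau> \<noteq> \<sigma>"
        using that 1 \<tau> by (intro UnI2 UN_I[of "(\<sigma>, \<tau>)"]) simp_all
      then show "\<tau> = \<sigma>" using elim by blast
    qed
  qed
qed

text \<open>
  By compactness every linear functional attains its maximum on some nonempty face.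
\<close>

lemma normal_fan_complete:
  fixes P :: "'a::euclidean_space set"
  assumes "compact P" "convex P" "P \<noteq> {}"
  shows "\<Union>(normal_fan P) = UNIV"
proof -
  have "y \<in> \<Union>(normal_fan P)" for y
  proof -
    have "\<exists>\<nu>\<in>P. \<forall>\<mu>\<in>P. y \<bullet> \<mu> \<le> y \<bullet> \<nu>"
      by (rule continuous_attains_sup[OF assms(1,3)]) (intro continuous_intros)
    then obtain \<nu> where \<nu>: "\<nu> \<in> P" "\<And>\<mu>. \<mu> \<in> P \<Longrightarrow> y \<bullet> \<mu> \<le> y \<bullet> \<nu>" by blast
    have "(P \<inter> {x. y \<bullet> x = y \<bullet> \<nu>}) face_of P"
      by (rule face_of_Int_supporting_hyperplane_le[OF assms(2) \<nu>(2)])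
    moreover have "P \<inter> {x. y \<bullet> x = y \<bullet> \<nu>} \<subseteq> max_face P y"
      using \<nu> by (auto simp: max_face_def)
    ultimately show ?thesis unfolding normal_fan_def using \<nu>(1) by blast
  qed
  then show ?thesis by blast
qed

lemma fan_refines_newton_complete:
  assumes "f \<noteq> 0" "g \<noteq> 0"
    and "fan_refines \<F> (normal_fan (newton_polytope f + newton_polytope g))"
  shows "\<Union>\<F> = UNIV"
proof -
  let ?P = "newton_polytope f + newton_polytope g"
  have "compact (newton_polytope f)" "compact (newton_polytope g)"
    by (simp_all add: newton_polytope_def finite_imp_compact_convex_hull)
  moreover have "?P = {x + y | x y. x \<in> newton_polytope f \<and> y \<in> newton_polytope g}"
    by (auto simp: set_plus_def)
  ultimately have cpt: "compact ?P" by (simp only: compact_sums)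
  have "newton_polytope f \<noteq> {}" "newton_polytope g \<noteq> {}"
    using assms(1,2) by (simp_all add: newton_polytope_def)
  then have ne: "?P \<noteq> {}" by (metis ex_in_conv set_plus_intro)
  have conv: "convex ?P" unfolding newton_polytope_def by (simp add: convex_set_plus)
  show ?thesis
    using assms(3) normal_fan_complete[OF cpt conv ne] by (simp add: fan_refines_def)
qed

lemma max_face_on_cone:
  fixes \<sigma> :: "'a::euclidean_space set"
  assumes gen: "simplicial_generators L \<sigma> B"
    and vertex: "\<And>y. y \<in> rel_interior \<sigma> \<Longrightarrow> \<nu> extreme_point_of max_face P y"
    and y: "y \<in> \<sigma>"
  shows "\<nu> \<in> max_face P y"
proof (rule max_face_closure_rel_interior[OF _ _ _ y])
  show "convex \<sigma>" "\<sigma> \<noteq> {}"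
    using gen convex_convex_cone_hull convex_cone_hull_nonempty
    unfolding simplicial_generators_def by metis+
  show "\<nu> \<in> max_face P z" if "z \<in> rel_interior \<sigma>" for z
    using vertex[OF that] by (simp add: extreme_point_of_def)
qed

lemma simplicial_generator_in_cone:
  assumes gen: "simplicial_generators L \<sigma> B" and b: "b \<in> B"
  shows "b \<in> \<sigma>" "b \<notin> L"
proof -
  show "b \<in> \<sigma>" using gen b by (simp add: simplicial_generators_def hull_inc)
  have "b \<noteq> 0" using gen b by (metis dependent_zero simplicial_generators_def)
  then show "b \<notin> L"
    using gen b unfolding simplicial_generators_def by (metis IntI singletonD span_base)
qed

lemma Exp_cone_borel:
  fixes V :: "int^'k^'n" and w :: "'n \<Rightarrow> real^'k"
  assumes "inj w" "simplicial_generators (ker V) \<sigma> (range w)"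
  shows "Exp_map V ` \<sigma> \<in> sets borel"
  unfolding Exp_image by (intro vexp_image_borel borel_closed closed_cone_image[OF assms])

lemma trop_integral_sum_cones:
  fixes V :: "int^'k^'n"
  assumes surj: "surj ((*v) (real_matrix V))"
    and fg: "f \<noteq> 0" "g \<noteq> 0" "cox_homogeneous V \<alpha> f" "cox_homogeneous V \<alpha> g"
    and fin: "finite C" and E: "\<And>\<sigma>. \<sigma> \<in> C \<Longrightarrow> Exp_map V ` \<sigma> \<in> sets borel"
    and cones: "AE u in lborel. \<exists>!\<sigma>. \<sigma> \<in> C \<and> u \<in> (*v) (real_matrix V) ` \<sigma>"
    and B[measurable]: "B \<in> sets borel"
  shows "trop_integral V f g B = (\<Sum>\<sigma>\<in>C. trop_integral V f g (Exp_map V ` \<sigma> \<inter> B))"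
proof -
  let ?A = "(*v) (real_matrix V)"
  let ?I = "trop_integral V f g" and ?E = "\<lambda>\<sigma>. Exp_map V ` \<sigma>"
  note [measurable] = trop_ratio_borel[OF surj fg]
  obtain c where c: "\<And>h. h \<in> borel_measurable borel \<Longrightarrow>
     (\<integral>\<^sup>+t. h t \<partial>(mult_haar :: (real^'n) measure)) = c * (\<integral>\<^sup>+u. h (vexp u) \<partial>lborel)"
    using nn_integral_mult_haar_vexp by blast
  let ?r = "\<lambda>u. ennreal (trop_ratio V f g (vexp u))"
  have EB: "?E \<sigma> \<inter> B \<in> sets borel" if "\<sigma> \<in> C" for \<sigma>
    using E[OF that] B by (rule sets.Int)
  have m: "(\<lambda>u. ?r u * indicator (?E \<sigma> \<inter> B) (vexp u)) \<in> borel_measurable lborel"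
    if "\<sigma> \<in> C" for \<sigma>
  proof -
    note [measurable] = EB[OF that]
    show ?thesis by measurable
  qed
  have "(\<Sum>\<sigma>\<in>C. ?I (?E \<sigma> \<inter> B)) =
      (\<Sum>\<sigma>\<in>C. c * (\<integral>\<^sup>+u. ?r u * indicator (?E \<sigma> \<inter> B) (vexp u) \<partial>lborel))"
    by (intro sum.cong refl trop_integral_log[OF surj fg c EB])
  also have "\<dots> = c * (\<integral>\<^sup>+u. (\<Sum>\<sigma>\<in>C. ?r u * indicator (?E \<sigma> \<inter> B) (vexp u)) \<partial>lborel)"
    by (simp add: nn_integral_sum[OF m] sum_distrib_left)
  also have "(\<integral>\<^sup>+u. (\<Sum>\<sigma>\<in>C. ?r u * indicator (?E \<sigma> \<inter> B) (vexp u)) \<partial>lborel) =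
      (\<integral>\<^sup>+u. ?r u * indicator B (vexp u) \<partial>lborel)"
  proof (rule nn_integral_cong_AE, use cones in eventually_elim)
    case (elim u)
    then obtain \<sigma> where \<sigma>: "\<sigma> \<in> C" "u \<in> ?A ` \<sigma>"
      and uniq: "\<And>\<tau>. \<tau> \<in> C \<Longrightarrow> u \<in> ?A ` \<tau> \<Longrightarrow> \<tau> = \<sigma>" by blast
    have mem: "vexp u \<in> ?E \<tau> \<longleftrightarrow> u \<in> ?A ` \<tau>" for \<tau>
      unfolding Exp_image by (auto dest: injD[OF inj_vexp])
    have "(\<Sum>\<tau>\<in>C. ?r u * indicator (?E \<tau> \<inter> B) (vexp u)) =
        (\<Sum>\<tau>\<in>C. if \<tau> = \<sigma> then ?r u * indicator B (vexp u) else 0)"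
    proof (rule sum.cong[OF refl])
      fix \<tau> assume "\<tau> \<in> C"
      then have "vexp u \<in> ?E \<tau> \<longleftrightarrow> \<tau> = \<sigma>" using \<sigma>(2) uniq[of \<tau>] mem[of \<tau>] by blast
      then show "?r u * indicator (?E \<tau> \<inter> B) (vexp u) =
          (if \<tau> = \<sigma> then ?r u * indicator B (vexp u) else 0)"
        by (cases "\<tau> = \<sigma>") (simp_all add: indicator_inter_arith)
    qed
    then show ?case using \<sigma> fin by simp
  qed
  also have "c * \<dots> = ?I B" by (rule trop_integral_log[OF surj fg c B, symmetric])
  finally show ?thesis by simp
qed

lemma trop_integral_X_pos:
  fixes V :: "int^'k^'n"
  assumes surj: "surj ((*v) (real_matrix V))"
  shows "trop_integral V f g (X_pos V) = trop_integral V f g UNIV"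
  unfolding trop_integral_def canonical_measure_eq_mult_haar[OF surj]
  by (rule nn_integral_cong_AE, use AE_mult_haar_pos in eventually_elim) simp

lemma emeasure_trop_measure:
  fixes V :: "int^'k^'n"
  assumes surj: "surj ((*v) (real_matrix V))"
    and fg: "f \<noteq> 0" "g \<noteq> 0" "cox_homogeneous V \<alpha> f" "cox_homogeneous V \<alpha> g"
    and [measurable]: "B \<in> sets borel"
  shows "emeasure (trop_measure V f g) B =
    trop_integral V f g B / trop_integral V f g (X_pos V)"
proof -
  note [measurable] = trop_ratio_borel[OF surj fg]
  note M = canonical_measure_eq_mult_haar(2)[OF surj]
  have "emeasure (trop_measure V f g) B =
      (\<integral>\<^sup>+t. (ennreal (trop_ratio V f g t) * indicator B t) / trop_integral V f g (X_pos V) \<partial>mult_haar)"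
    unfolding trop_measure_def M by (subst emeasure_density) (simp_all add: divide_ennreal_def ac_simps)
  also have "\<dots> = trop_integral V f g B / trop_integral V f g (X_pos V)"
    unfolding trop_integral_def M by (rule nn_integral_divide) measurable
  finally show ?thesis .
qed

lemma prob_space_unit_cube: "prob_space (unit_cube :: (real^'n) measure)"
  unfolding unit_cube_def by (rule prob_space_uniform_measure) (simp_all add: emeasure_cbox_0_1)

lemma sampler_output_borel:
  fixes V :: "int^'k^'n"
  assumes "finite (fan_cones (ker V) \<F> CARD('n))"
  shows "sampler_output V w \<delta> \<in> borel_measurable (draw_measure V f g \<F>)"
proof -
  let ?full = "fan_cones (ker V) \<F> CARD('n)"
  have "sampler_output V w \<delta> \<in> borel_measurable (count_space ?full \<Otimes>\<^sub>M borel)"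
    by (rule measurable_pair_measure_countable1)
      (use assms in \<open>simp_all add: sampler_output_def countable_finite sampler_borel\<close>)
  moreover have "sets (draw_measure V f g \<F>) = sets (count_space ?full \<Otimes>\<^sub>M borel)"
    unfolding draw_measure_def by (intro sets_pair_measure_cong) (simp_all add: sets_point_measure)
  ultimately show ?thesis by (simp cong: measurable_cong_sets)
qed

theorem mainTheorem3:
  fixes \<Delta> :: "(real^'n) set set"
    and V :: "int^'k^'n"
    and f g :: "('k::finite) cox_poly"
    and \<alpha> :: "(int^'k) set"
    and \<F> :: "(real^'k) set set"
    and w :: "(real^'k) set \<Rightarrow> 'n \<Rightarrow> real^'k"
    and \<nu>\<^sub>f \<nu>\<^sub>g \<delta> :: "(real^'k) set \<Rightarrow> real^'k"
  assumes fan: "complete_rational_fan \<Delta>"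
    and rays: "ray_matrix \<Delta> V"
    and nonzero: "f \<noteq> 0" "g \<noteq> 0"
    and positive: "positive_coeffs f" "positive_coeffs g"
    and homogeneous: "cox_homogeneous V \<alpha> f" "cox_homogeneous V \<alpha> g"
    and dim_newton: "aff_dim (newton_polytope g) = int CARD('n)"
    and newton: "newton_polytope f \<subseteq> rel_interior (newton_polytope g)"
    and simplicial: "simplicial_fan (ker V) \<F>"
    and refinement: "fan_refines \<F> (normal_fan (newton_polytope f + newton_polytope g))"
    and generators: "\<And>\<sigma>. \<sigma> \<in> fan_cones (ker V) \<F> CARD('n) \<Longrightarrow>
      inj (w \<sigma>) \<and> simplicial_generators (ker V) \<sigma> (range (w \<sigma>))"
    and vertices: "\<And>\<sigma> y. \<sigma> \<in> fan_cones (ker V) \<F> CARD('n) \<Longrightarrow> y \<in> rel_interior \<sigma> \<Longrightarrow>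
      \<nu>\<^sub>f \<sigma> extreme_point_of max_face (newton_polytope f) y \<and>
      \<nu>\<^sub>g \<sigma> extreme_point_of max_face (newton_polytope g) y"
    and delta: "\<And>\<sigma>. \<sigma> \<in> fan_cones (ker V) \<F> CARD('n) \<Longrightarrow> \<delta> \<sigma> = \<nu>\<^sub>g \<sigma> - \<nu>\<^sub>f \<sigma>"
  shows "prob_space (trop_measure V f g) \<and>
    (AE p in draw_measure V f g \<F>. sampler_output V w \<delta> p \<in> X_pos V) \<and>
    distr (draw_measure V f g \<F>) borel (sampler_output V w \<delta>) = trop_measure V f g"
proof -
  let ?A = "(*v) (real_matrix V)" and ?full = "fan_cones (ker V) \<F> CARD('n)"
  let ?I = "trop_integral V f g" and ?E = "\<lambda>\<sigma>. Exp_map V ` \<sigma>"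
  let ?tot = "?I (X_pos V)"
  have surj: "surj ?A" and dimK: "dim (ker V) + CARD('n) = CARD('k)"
    by (rule surj_real_matrix[OF homogeneous(2) nonzero(2) dim_newton])+
  note fg = nonzero homogeneous
  have X: "X_pos V = pos_orthant" and M: "canonical_measure V = mult_haar"
    using canonical_measure_eq_mult_haar[OF surj] by auto
  have pfan: "polyhedral_fan (ker V) \<F>" using simplicial by (simp add: simplicial_fan_def)
  have finf: "finite ?full" using pfan by (simp add: fan_cones_def polyhedral_fan_def)
  have gen: "inj (w \<sigma>)" "simplicial_generators (ker V) \<sigma> (range (w \<sigma>))" if "\<sigma> \<in> ?full" for \<sigma>
    using generators[OF that] by auto
  have cones: "AE u in lborel. \<exists>!\<sigma>. \<sigma> \<in> ?full \<and> u \<in> ?A ` \<sigma>"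
    by (rule AE_unique_cone[OF surj dimK pfan fan_refines_newton_complete[OF nonzero refinement]])
  have split: "?I B = (\<Sum>\<sigma>\<in>?full. ?I (?E \<sigma> \<inter> B))" if "B \<in> sets borel" for B
    by (rule trop_integral_sum_cones[OF surj fg finf Exp_cone_borel[OF gen] cones that])

  have step: "\<exists>c. \<forall>B\<in>sets borel.
      (\<integral>\<^sup>+q. indicator B (cox_map V (cox_sample (w \<sigma>) (\<delta> \<sigma>) q)) \<partial>unit_cube) = c * ?I (?E \<sigma> \<inter> B)"
    if \<sigma>: "\<sigma> \<in> ?full" for \<sigma>
  proof (rule cone_sampler[OF surj fg gen[OF \<sigma>]])
    have mf: "\<nu>\<^sub>f \<sigma> \<in> max_face (newton_polytope f) y" and mg: "\<nu>\<^sub>g \<sigma> \<in> max_face (newton_polytope g) y"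
      if "y \<in> \<sigma>" for y
      by (rule max_face_on_cone[OF gen(2)[OF \<sigma>] _ that]; use vertices[OF \<sigma>] in blast)+
    show "support_value g y - support_value f y = y \<bullet> \<delta> \<sigma>" if "y \<in> \<sigma>" for y
      using support_value_eq_max_face[OF nonzero(1) mf[OF that]]
        support_value_eq_max_face[OF nonzero(2) mg[OF that]]
      by (simp add: delta[OF \<sigma>] inner_diff_right inner_commute)
    show "0 < w \<sigma> l \<bullet> \<delta> \<sigma>" for l
    proof -
      have l: "w \<sigma> l \<in> \<sigma>" "w \<sigma> l \<notin> ker V"
        using simplicial_generator_in_cone[OF gen(2)[OF \<sigma>]] by auto
      have "\<nu>\<^sub>f \<sigma> \<in> rel_interior (newton_polytope g)"
        using mf[OF l(1)] newton by (auto simp: max_face_def)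
      then have "w \<sigma> l \<bullet> \<nu>\<^sub>f \<sigma> < w \<sigma> l \<bullet> \<nu>\<^sub>g \<sigma>"
        using l mg by (intro inner_less_of_rel_interior[OF homogeneous(2) nonzero(2) dim_newton])
      then show ?thesis by (simp add: delta[OF \<sigma>] inner_diff_right)
    qed
  qed

  have prob_cube: "prob_space (unit_cube :: (real^'n) measure)" by (rule prob_space_unit_cube)
  \<comment> \<open>the constant for the cone is the inverse of its integral, as the choice of the whole space for the target set shows; so the integral is positive and finite\<close>
  have cone_integral: "?I (?E \<sigma>) \<noteq> 0 \<and> ?I (?E \<sigma>) \<noteq> \<infinity>"
    and cube: "\<And>B. B \<in> sets borel \<Longrightarrow>
      ?I (?E \<sigma>) * (\<integral>\<^sup>+q. indicator B (cox_map V (cox_sample (w \<sigma>) (\<delta> \<sigma>) q)) \<partial>unit_cube) = ?I (?E \<sigma> \<inter> B)"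
    if \<sigma>: "\<sigma> \<in> ?full" for \<sigma>
  proof -
    obtain c' where c': "\<And>B. B \<in> sets borel \<Longrightarrow>
      (\<integral>\<^sup>+q. indicator B (cox_map V (cox_sample (w \<sigma>) (\<delta> \<sigma>) q)) \<partial>unit_cube) = c' * ?I (?E \<sigma> \<inter> B)"
      using step[OF \<sigma>] by blast
    have 1: "c' * ?I (?E \<sigma>) = 1"
      using c'[of UNIV] prob_space.emeasure_space_1[OF prob_cube] by simp
    show "?I (?E \<sigma>) \<noteq> 0 \<and> ?I (?E \<sigma>) \<noteq> \<infinity>"
      using 1 by (auto simp: ennreal_mult_top split: if_splits)
    show "?I (?E \<sigma>) * (\<integral>\<^sup>+q. indicator B (cox_map V (cox_sample (w \<sigma>) (\<delta> \<sigma>) q)) \<partial>unit_cube) = ?I (?E \<sigma> \<inter> B)"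
      if "B \<in> sets borel" for B
    proof -
      have "?I (?E \<sigma>) * (c' * ?I (?E \<sigma> \<inter> B)) = c' * ?I (?E \<sigma>) * ?I (?E \<sigma> \<inter> B)"
        by (simp only: ac_simps)
      then show ?thesis unfolding c'[OF that] 1 by simp
    qed
  qed

  have tot: "?tot = (\<Sum>\<sigma>\<in>?full. ?I (?E \<sigma>))"
    using trop_integral_X_pos[OF surj] split[of UNIV] by simp
  have "?full \<noteq> {}"
  proof
    assume "?full = {}"
    then have "AE u in (lborel :: (real^'n) measure). False"
      using cones by (auto elim: eventually_mono)
    then show False by (simp add: eventually_False ae_filter_eq_bot_iff)
  qed
  then obtain \<sigma>0 where \<sigma>0: "\<sigma>0 \<in> ?full" by blast
  have tot0: "?tot \<noteq> 0" using cone_integral[OF \<sigma>0] finf \<sigma>0 unfolding tot by auto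
  have tot_fin: "?tot \<noteq> \<infinity>" using cone_integral unfolding tot by (simp add: ennreal_sum_eq_top finf)

  note trop = emeasure_trop_measure[OF surj fg]
  have sp: "space (trop_measure V f g) = UNIV" and st: "sets (trop_measure V f g) = sets borel"
    by (simp_all add: trop_measure_def M)
  have prob: "prob_space (trop_measure V f g)"
    by (rule prob_spaceI)
      (use trop_integral_X_pos[OF surj, of f g] tot0 tot_fin in \<open>simp add: sp trop ennreal_divide_self top.not_eq_extremum\<close>)

  have out: "sampler_output V w \<delta> \<in> borel_measurable (draw_measure V f g \<F>)"
    by (rule sampler_output_borel[OF finf])
  have distr: "distr (draw_measure V f g \<F>) borel (sampler_output V w \<delta>) = trop_measure V f g"
  proof (rule measure_eqI)
    fix B assume "B \<in> sets (distr (draw_measure V f g \<F>) borel (sampler_output V w \<delta>))"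
    then have B[measurable]: "B \<in> sets borel" by simp
    let ?p = "\<lambda>\<sigma>. ?I (?E \<sigma>) / ?tot"
    interpret U: prob_space "unit_cube :: (real^'n) measure" by (rule prob_cube)
    have D: "draw_measure V f g \<F> = point_measure ?full ?p \<Otimes>\<^sub>M unit_cube"
      by (simp add: draw_measure_def unit_cube_def)
    have "emeasure (distr (draw_measure V f g \<F>) borel (sampler_output V w \<delta>)) B =
        (\<integral>\<^sup>+p. indicator B (sampler_output V w \<delta> p) \<partial>draw_measure V f g \<F>)"
      using out by (simp add: nn_integral_distr flip: nn_integral_indicator)
    also have "\<dots> = (\<integral>\<^sup>+\<sigma>. (\<integral>\<^sup>+q. indicator B (sampler_output V w \<delta> (\<sigma>, q)) \<partial>unit_cube) \<partial>point_measure ?full ?p)"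
      unfolding D
      by (rule U.nn_integral_fst[symmetric],
          rule measurable_compose[OF out[unfolded D] borel_measurable_indicator[OF B]])
    also have "\<dots> = (\<Sum>\<sigma>\<in>?full. ?p \<sigma> * (\<integral>\<^sup>+q. indicator B (cox_map V (cox_sample (w \<sigma>) (\<delta> \<sigma>) q)) \<partial>unit_cube))"
      by (simp add: nn_integral_point_measure_finite[OF finf] sampler_output_def)
    also have "\<dots> = (\<Sum>\<sigma>\<in>?full. ?I (?E \<sigma> \<inter> B) / ?tot)"
    proof (rule sum.cong[OF refl])
      fix \<sigma> assume \<sigma>: "\<sigma> \<in> ?full"
      have "a / ?tot * b = a * b / ?tot" for a b :: ennreal
        by (simp add: divide_ennreal_def ac_simps)
      then show "?p \<sigma> * (\<integral>\<^sup>+q. indicator B (cox_map V (cox_sample (w \<sigma>) (\<delta> \<sigma>) q)) \<partial>unit_cube) =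
          ?I (?E \<sigma> \<inter> B) / ?tot"
        by (simp only: cube[OF \<sigma> B])
    qed
    also have "\<dots> = ?I B / ?tot"
      unfolding split[OF B] by (simp add: divide_ennreal_def sum_distrib_right)
    also have "\<dots> = emeasure (trop_measure V f g) B" by (rule trop[OF B, symmetric])
    finally show "emeasure (distr (draw_measure V f g \<F>) borel (sampler_output V w \<delta>)) B =
        emeasure (trop_measure V f g) B" .
  qed (simp add: st)

  have "AE t in trop_measure V f g. t \<in> X_pos V"
    using AE_mult_haar_pos trop_ratio_borel[OF surj fg]
    unfolding trop_measure_def M X by (subst AE_density) auto
  then have "AE t in distr (draw_measure V f g \<F>) borel (sampler_output V w \<delta>). t \<in> X_pos V"
    unfolding distr .
  then have "AE p in draw_measure V f g \<F>. sampler_output V w \<delta> p \<in> X_pos V"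
    by (subst (asm) AE_distr_iff) (use out in \<open>auto simp: X\<close>)
  with prob distr show ?thesis by blast
qed

end
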